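(* For any class $\mathcal{H}$ of hypergraphs, if $\mathcal{H}$ has unbounded hypertree width and bounded fractional hypertree width, then $\mathcal{H}$ is exotic.
   Context: A class $\mathcal{H}$ of hypergraphs is exotic if for every integer $n\ge1$ there exist $H\in\mathcal{H}$ and a set $U\subseteq V(H)$ of $n$ vertices such that the induced subhypergraph $H[U]=(U,\{e\cap U: e\in E(H)\}\setminus\{\emptyset\})$ has at least $2^n-1$ distinct edges. A tree decomposition of $H$ is a tree $T$ with bags $B_u\subseteq V(H)$ such that each hyperedge lies in some bag and each vertex's bags form a connected subtree. A fractional edge cover of $X\subseteq V(H)$ is $\gamma:E(H)\to\mathbb{R}^+$ with $\sum_{e\ni v}\gamma(e)\ge1$ for all $v\in X$; $\rho^*_H(X)$ is the minimum total weight of such a cover. The fractional hypertree width $fhw(H)$ is the minimum over tree decompositions of $\max_u\rho^*_H(B_u)$. A hypertree decomposition of $H$ is a rooted tree $T$ with bags $B_u\subseteq V(H)$ and covers $\lambda_u\subseteq E(H)$ such that: each vertex's bags form a connected subtree; each hyperedge is contained in some bag; $B_u\subseteq\bigcup\lambda_u$; and $(\bigcup\lambda_u)\cap B(T_u)\subseteq B_u$, where $B(T_u)$ is the union of bags in the subtree rooted at $u$. Its width is $\max_u|\lambda_u|$ and the hypertree width $hw(H)$ is the minimum width over hypertree decompositions. A class has bounded width if some constant bounds the width of all its members. *)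

theory Defs
  imports "Graph_Theory.Digraph_Component" "HOL-Library.Extended_Real"
begin

record 'a hypergraph =
  hverts :: "'a set"
  hedges :: "'a set set"

definition hypergraph :: "'a hypergraph \<Rightarrow> bool" where
  "hypergraph H \<longleftrightarrow> finite (hverts H) \<and> hedges H \<subseteq> Pow (hverts H)"

definition induced_subhypergraph :: "'a hypergraph \<Rightarrow> 'a set \<Rightarrow> 'a hypergraph" where
  "induced_subhypergraph H U =
     \<lparr>hverts = U, hedges = {e \<inter> U | e. e \<in> hedges H} - {{}}\<rparr>"

definition exotic :: "'a hypergraph set \<Rightarrow> bool" where
  "exotic C \<longleftrightarrow>
     (\<forall>n\<ge>1. \<exists>H\<in>C. \<exists>U. U \<subseteq> hverts H \<and> card U = n \<and>
        2 ^ n - 1 \<le> card (hedges (induced_subhypergraph H U)))"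

text \<open>
  An undirected graph is a symmetric digraph without loops (\<^locale>\<open>pair_graph\<close>).
  The library constant \<^const>\<open>tree\<close> cannot be used for undirected trees: it forbids
  every directed cycle, so it rejects symmetric digraphs with an edge (where a, b, a is a
  cycle) and accepts acyclic orientations of graphs that are not trees. Only cycles of
  length at least 3 are cycles of the undirected graph. Note that \<^const>\<open>connected\<close>
  requires a nonempty vertex set.
\<close>

definition undirected_tree :: "'n pair_pre_digraph \<Rightarrow> bool" where
  "undirected_tree T \<longleftrightarrow>
     pair_graph T \<and> connected (with_proj T) \<and>
     \<not> (\<exists>p. pre_digraph.cycle (with_proj T) p \<and> 3 \<le> length p)"

text \<open>The nodes of the subtree rooted at \<open>u\<close>, when \<open>T\<close> is rooted at \<open>r\<close>.\<close>

definition rooted_subtree :: "'n pair_pre_digraph \<Rightarrow> 'n \<Rightarrow> 'n \<Rightarrow> 'n set" where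
  "rooted_subtree T r u =
     {w \<in> pverts T. \<exists>p. pre_digraph.apath (with_proj T) r p w \<and>
                        u \<in> set (pre_digraph.awalk_verts (with_proj T) r p)}"

definition tree_decomposition ::
    "'a hypergraph \<Rightarrow> 'n pair_pre_digraph \<Rightarrow> ('n \<Rightarrow> 'a set) \<Rightarrow> bool" where
  "tree_decomposition H T B \<longleftrightarrow>
     undirected_tree T \<and>
     (\<forall>u\<in>pverts T. B u \<subseteq> hverts H) \<and>
     (\<forall>e\<in>hedges H. \<exists>u\<in>pverts T. e \<subseteq> B u) \<and>
     (\<forall>v\<in>hverts H. connected (with_proj T \<restriction> {u \<in> pverts T. v \<in> B u}))"

definition fractional_edge_cover :: "'a hypergraph \<Rightarrow> 'a set \<Rightarrow> ('a set \<Rightarrow> real) \<Rightarrow> bool" where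
  "fractional_edge_cover H X \<gamma> \<longleftrightarrow>
     (\<forall>e\<in>hedges H. 0 \<le> \<gamma> e) \<and>
     (\<forall>v\<in>X. 1 \<le> (\<Sum>e\<in>{e \<in> hedges H. v \<in> e}. \<gamma> e))"

text \<open>
  The three minima below are infima, with value \<open>\<infinity>\<close> if there is nothing to
  minimise over; this happens only when some vertex lies in no hyperedge. Node sets of trees
  are finite, so taking the nodes from \<^typ>\<open>nat\<close> is no restriction.
\<close>

definition fractional_cover_number :: "'a hypergraph \<Rightarrow> 'a set \<Rightarrow> ereal" where
  "fractional_cover_number H X =
     (INF \<gamma>\<in>{\<gamma>. fractional_edge_cover H X \<gamma>}. ereal (\<Sum>e\<in>hedges H. \<gamma> e))"

definition fhw :: "'a hypergraph \<Rightarrow> ereal" where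
  "fhw H =
     (INF (T, B)\<in>{(T :: nat pair_pre_digraph, B). tree_decomposition H T B}.
        MAX u\<in>pverts T. fractional_cover_number H (B u))"

definition hypertree_decomposition ::
    "'a hypergraph \<Rightarrow> 'n pair_pre_digraph \<Rightarrow> 'n \<Rightarrow> ('n \<Rightarrow> 'a set) \<Rightarrow> ('n \<Rightarrow> 'a set set) \<Rightarrow> bool" where
  "hypertree_decomposition H T r B L \<longleftrightarrow>
     tree_decomposition H T B \<and> r \<in> pverts T \<and>
     (\<forall>u\<in>pverts T. L u \<subseteq> hedges H \<and> B u \<subseteq> \<Union>(L u) \<and>
        \<Union>(L u) \<inter> (\<Union>w\<in>rooted_subtree T r u. B w) \<subseteq> B u)"

definition hw :: "'a hypergraph \<Rightarrow> enat" where
  "hw H =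
     (INF (T, r, B, L)\<in>{(T :: nat pair_pre_digraph, r, B, L). hypertree_decomposition H T r B L}.
        enat (MAX u\<in>pverts T. card (L u)))"

definition bounded_fhw :: "'a hypergraph set \<Rightarrow> bool" where
  "bounded_fhw C \<longleftrightarrow> (\<exists>c::real. \<forall>H\<in>C. fhw H \<le> ereal c)"

definition bounded_hw :: "'a hypergraph set \<Rightarrow> bool" where
  "bounded_hw C \<longleftrightarrow> (\<exists>c::nat. \<forall>H\<in>C. hw H \<le> enat c)"

end

theory Submission
  imports Defs "HOL-Library.FuncSet" "HOL-Library.Disjoint_Sets"
begin

text \<open>
  If the class is not exotic, then for some \<open>n\<close> no \<open>n\<close> vertices carry all \<open>2\<^sup>n - 1\<close> nonempty
  traces, so the dual set systems (hyperedges as points, vertices as sets) have VC dimension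
  below \<open>2\<^sup>n\<close>. An edge cover of a bag is a hitting set of the dual system and a fractional cover
  of weight at most \<open>c\<close> is a measure giving each dual set mass at least \<open>1/c\<close>; the epsilon-net
  theorem then covers every bag of a decomposition of small fractional width by boundedly many
  hyperedges. Finally, covering all bags of a tree decomposition by \<open>k\<close> hyperedges each bounds the
  hypertree width by \<open>3k + 1\<close> (Adler, Gottlob and Grohe): every set of at most \<open>2k + 1\<close>
  hyperedges has a balanced separator made of \<open>k\<close> hyperedges, and separating recursively builds
  a hypertree decomposition from the root downwards.
\<close>

section \<open>Acyclic graphs and trees\<close>

text \<open>Two obstacles shape the argument. An integral cover of a bag may exceed a fractional one
  by a factor that grows with the hypergraph; bounded VC dimension of the dual system makes the
  number of hyperedges depend only on \<open>n\<close> and the fractional bound. Moreover, covering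
  each bag by \<open>k\<close> hyperedges says nothing about the condition relating
  \<open>\<Union>(L u)\<close> to the bags below \<open>u\<close>. The given tree therefore supplies
  nothing but separators, and a new tree is grown whose bags take from \<open>\<Union>(L u)\<close>
  everything that can occur further down. The width \<open>3k + 1\<close> adds up at most
  \<open>2k\<close> hyperedges covering the boundary of the current vertex set, one hyperedge that
  guarantees progress, and \<open>k\<close> hyperedges of the separator.\<close>

definition connected_in :: "('n \<times> 'n) set \<Rightarrow> 'n set \<Rightarrow> bool" where
  "connected_in E K \<longleftrightarrow> (\<forall>x\<in>K. \<forall>y\<in>K. (x, y) \<in> (E \<inter> K \<times> K)\<^sup>*)"

text \<open>An edge and its reverse in a symmetric relation must not count as a cycle, hence the
  three distinct entries. Loops stay possible, which is why the leaf lemma allows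
  \<open>y = x\<close>.\<close>

definition no_cycle :: "('n \<times> 'n) set \<Rightarrow> 'n set \<Rightarrow> bool" where
  "no_cycle E V \<longleftrightarrow> \<not> (\<exists>xs. distinct xs \<and> 3 \<le> length xs \<and> set xs \<subseteq> V \<and>
     successively (\<lambda>x y. (x, y) \<in> E) xs \<and> (last xs, hd xs) \<in> E)"

lemma no_cycle_mono: "no_cycle E V \<Longrightarrow> W \<subseteq> V \<Longrightarrow> no_cycle E W"
  unfolding no_cycle_def by blast

text \<open>An end \<open>x\<close> of a longest path is a leaf: a neighbour off the path would
  prolong it, and a neighbour on the path beyond the second vertex \<open>p\<close> would close a
  cycle of length at least 3.\<close>

lemma no_cycle_leaf:
  assumes "finite V" "V \<noteq> {}" and sym: "sym E" and nc: "no_cycle E V"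
  obtains x p where "x \<in> V" "\<And>y. y \<in> V \<Longrightarrow> (x, y) \<in> E \<Longrightarrow> y = x \<or> y = p"
proof -
  define P where "P xs \<longleftrightarrow> distinct xs \<and> xs \<noteq> [] \<and> set xs \<subseteq> V \<and> successively (\<lambda>x y. (x, y) \<in> E) xs" for xs
  obtain v where "v \<in> V" using assms(2) by blast
  then have "P [v]" by (simp add: P_def)
  moreover have "length xs < Suc (card V)" if "P xs" for xs
    using that assms(1) by (metis P_def card_mono distinct_card le_imp_less_Suc)
  ultimately obtain xs where xs: "P xs" and max: "\<And>ys. P ys \<Longrightarrow> length ys \<le> length xs"
    using ex_has_greatest_nat[of P "[v]" length "Suc (card V)"] by blast
  obtain x zs where xz: "xs = x # zs" using xs by (cases xs) (auto simp: P_def)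
  have inxs: "y \<in> set xs" if "y \<in> V" "(x, y) \<in> E" for y
  proof (rule ccontr)
    assume "y \<notin> set xs"
    then have "P (y # xs)" using xs that symD[OF sym that(2)] by (auto simp: P_def xz)
    from max[OF this] show False by simp
  qed
  show thesis
  proof (cases zs)
    case Nil
    show ?thesis by (rule that[of x x]) (use inxs xs in \<open>auto simp: P_def xz Nil\<close>)
  next
    case (Cons p ws)
    have "y = x \<or> y = p" if y: "y \<in> V" "(x, y) \<in> E" for y
    proof (rule ccontr)
      assume ne: "\<not> (y = x \<or> y = p)"
      then have "y \<in> set ws" using inxs[OF y] by (simp add: xz Cons)
      then obtain as bs where ws: "ws = as @ y # bs" by (meson split_list)
      let ?c = "x # p # as @ [y]"
      have eq: "xs = ?c @ bs" by (simp add: xz Cons ws)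
      have "successively (\<lambda>x y. (x, y) \<in> E) (?c @ bs)" "distinct (?c @ bs)" "set (?c @ bs) \<subseteq> V"
        using xs unfolding P_def eq by auto
      then have "successively (\<lambda>x y. (x, y) \<in> E) ?c" "distinct ?c" "set ?c \<subseteq> V"
        unfolding successively_append_iff by auto
      moreover have "(last ?c, hd ?c) \<in> E" using symD[OF sym y(2)] by simp
      moreover have "3 \<le> length ?c" by simp
      ultimately show False using nc unfolding no_cycle_def by blast
    qed
    then show ?thesis using that[of x p] xs by (auto simp: P_def xz)
  qed
qed

lemma connected_in_neighbour:
  assumes "connected_in E K" "x \<in> K" "K \<noteq> {x}"
  obtains y where "y \<in> K" "y \<noteq> x" "(x, y) \<in> E"
proof -
  obtain z where z: "z \<in> K" "z \<noteq> x" using assms by blast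
  have "(x, z) \<in> (E \<inter> K \<times> K)\<^sup>*" using assms z by (simp add: connected_in_def)
  then have "z = x \<or> (\<exists>y\<in>K. y \<noteq> x \<and> (x, y) \<in> E)"
    by (induction rule: rtrancl_induct) auto
  then show thesis using z that by blast
qed

text \<open>Apart from loops, a walk enters \<open>x\<close> only from \<open>p\<close> and leaves
  it only to \<open>p\<close>, so its visits to \<open>x\<close> can be cut out.\<close>

lemma connected_in_remove_leaf:
  assumes conn: "connected_in E K" and sym: "sym E"
    and leaf: "\<And>y. y \<in> K \<Longrightarrow> (x, y) \<in> E \<Longrightarrow> y = x \<or> y = p"
  shows "connected_in E (K - {x})"
  unfolding connected_in_def
proof (intro ballI)
  fix a b assume a: "a \<in> K - {x}" and b: "b \<in> K - {x}"
  let ?R = "E \<inter> (K - {x}) \<times> (K - {x})"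
  have "(a, b) \<in> (E \<inter> K \<times> K)\<^sup>*" using conn a b by (simp add: connected_in_def)
  \<comment> \<open>While the walk stands at \<open>x\<close>, the invariant keeps the reduced walk
    waiting at \<open>p\<close>.\<close>
  then have "if b = x then (a, p) \<in> ?R\<^sup>* else (a, b) \<in> ?R\<^sup>*"
  proof (induction rule: rtrancl_induct)
    case base
    then show ?case using a by auto
  next
    case (step b c)
    show ?case
    proof (cases "b = x")
      case True
      then show ?thesis using step leaf[of c] by (auto split: if_splits)
    next
      case False
      then have ab: "(a, b) \<in> ?R\<^sup>*" using step by simp
      show ?thesis
      proof (cases "c = x")
        case True
        then have "b = p" using leaf[of b] step(2) False symD[OF sym, of b x] by auto
        then show ?thesis using ab True by simp
      next
        case False
        then have "(b, c) \<in> ?R" using \<open>b \<noteq> x\<close> step(2) by auto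
        then show ?thesis using ab False by (simp add: rtrancl.rtrancl_into_rtrancl)
      qed
    qed
  qed
  then show "(a, b) \<in> ?R\<^sup>*" using b by auto
qed

text \<open>
  Acyclicity alone suffices, so the induction may delete a vertex with at most one neighbour
  without keeping the graph connected.
\<close>

theorem helly_acyclic:
  assumes "finite V" "sym E" "no_cycle E V" "\<K> \<noteq> {}"
    and "\<And>K. K \<in> \<K> \<Longrightarrow> K \<noteq> {} \<and> K \<subseteq> V \<and> connected_in E K"
    and "\<And>K K'. K \<in> \<K> \<Longrightarrow> K' \<in> \<K> \<Longrightarrow> K \<inter> K' \<noteq> {}"
  shows "\<Inter>\<K> \<noteq> {}"
  using assms
proof (induction "card V" arbitrary: V \<K>)
  case 0
  then show ?case by auto
next
  case (Suc n)
  have "V \<noteq> {}" using Suc.hyps(2) by auto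
  obtain x p where x: "x \<in> V" and leaf: "\<And>y. y \<in> V \<Longrightarrow> (x, y) \<in> E \<Longrightarrow> y = x \<or> y = p"
    using no_cycle_leaf[OF Suc.prems(1) \<open>V \<noteq> {}\<close> Suc.prems(2,3)] by blast
  show ?case
  proof (cases "{x} \<in> \<K>")
    case True
    then have "x \<in> K" if "K \<in> \<K>" for K using Suc.prems(6)[OF that True] by auto
    then show ?thesis by auto
  next
    case False
    \<comment> \<open>A member through \<open>x\<close> other than \<open>{x}\<close> contains the
      only neighbour \<open>p\<close>; two members that met in \<open>x\<close> still meet in
      \<open>p\<close> once \<open>x\<close> is deleted.\<close>
    have p: "p \<in> K \<and> p \<noteq> x" if "K \<in> \<K>" "x \<in> K" for K
    proof -
      have "K \<noteq> {x}" using False that by auto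
      moreover have "connected_in E K" "K \<subseteq> V" using Suc.prems(5) that by auto
      ultimately show ?thesis using connected_in_neighbour[of E K x] leaf that(2) by (metis subsetD)
    qed
    have "\<Inter>((\<lambda>K. K - {x}) ` \<K>) \<noteq> {}"
    proof (rule Suc.hyps(1)[of "V - {x}"])
      show "n = card (V - {x})" using Suc.hyps(2) Suc.prems(1) x by simp
      show "no_cycle E (V - {x})" using no_cycle_mono[OF Suc.prems(3)] by blast
      show "L \<noteq> {} \<and> L \<subseteq> V - {x} \<and> connected_in E L" if L: "L \<in> (\<lambda>K. K - {x}) ` \<K>" for L
      proof -
        obtain K where K: "K \<in> \<K>" "L = K - {x}" using L by blast
        have KV: "K \<noteq> {} \<and> K \<subseteq> V \<and> connected_in E K" using Suc.prems(5) K(1) by auto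
        then have "connected_in E L" unfolding K(2)
          by (intro connected_in_remove_leaf[where p = p]) (use leaf Suc.prems(2) in auto)
        moreover have "L \<noteq> {}" using KV K False by (metis Diff_eq_empty_iff subset_singleton_iff)
        ultimately show ?thesis using KV K(2) by auto
      qed
      show "L \<inter> L' \<noteq> {}" if LL: "L \<in> (\<lambda>K. K - {x}) ` \<K>" "L' \<in> (\<lambda>K. K - {x}) ` \<K>" for L L'
      proof -
        obtain K K' where K: "K \<in> \<K>" "L = K - {x}" "K' \<in> \<K>" "L' = K' - {x}" using LL by blast
        obtain z where z: "z \<in> K" "z \<in> K'" using Suc.prems(6)[OF K(1,3)] by auto
        show ?thesis
        proof (cases "z = x")
          case True
          then show ?thesis using p[OF K(1)] p[OF K(3)] z K by auto
        qed (use z K in auto)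
      qed
    qed (use Suc.prems in auto)
    then show ?thesis using Suc.prems(4) by auto
  qed
qed

section \<open>Trees of the digraph library as symmetric relations\<close>

lemma symcl_id: "sym R \<Longrightarrow> R\<^sup>s = R"
  by (auto simp: symcl_def dest: symD)

lemma rtrancl_on_eq: "a \<in> F \<Longrightarrow> b \<in> F \<Longrightarrow> (a, b) \<in> rtrancl_on F R \<longleftrightarrow> (a, b) \<in> (R \<inter> F \<times> F)\<^sup>*"
proof
  assume "(a, b) \<in> rtrancl_on F R"
  then show "(a, b) \<in> (R \<inter> F \<times> F)\<^sup>*"
    by (induction rule: rtrancl_on_induct) (auto intro: rtrancl.rtrancl_into_rtrancl)
next
  assume F: "a \<in> F" "b \<in> F" and "(a, b) \<in> (R \<inter> F \<times> F)\<^sup>*"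
  from this(3) show "(a, b) \<in> rtrancl_on F R"
    by (induction rule: rtrancl_induct) (use F in \<open>auto intro: rtrancl_on.rtrancl_on_into_rtrancl_on\<close>)
qed

lemma connected_induce_iff:
  assumes "sym (parcs T)"
  shows "connected (with_proj T \<restriction> K) \<longleftrightarrow> K \<noteq> {} \<and> connected_in (parcs T) K"
proof -
  have ends: "arcs_ends (with_proj T \<restriction> K) = parcs T \<inter> K \<times> K"
    by (auto simp: arcs_ends_def arc_to_ends_def induce_subgraph_def)
  have "sym (parcs T \<inter> K \<times> K)" using assms by (auto simp: sym_def)
  then show ?thesis
    unfolding connected_conv ends connected_in_def
    by (auto simp: symcl_id rtrancl_on_eq)
qed

lemma connected_with_proj_iff:
  assumes "sym (parcs T)"
  shows "connected (with_proj T) \<longleftrightarrow> pverts T \<noteq> {} \<and> connected_in (parcs T) (pverts T)"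
  unfolding connected_conv connected_in_def
  by (auto simp: symcl_id assms rtrancl_on_eq)

lemma pair_graph_sym: "pair_graph T \<Longrightarrow> sym (parcs T)"
  using pair_sym_digraph.arcs_symmetric[of T] pair_graph_def pair_pseudo_graph_def
  by (metis symI pair_graph.axioms(2) pair_pseudo_graph.axioms(2))

lemma pair_graph_finite: "pair_graph T \<Longrightarrow> finite (pverts T)"
  by (simp add: pair_graph_def pair_digraph_def pair_fin_digraph.pair_finite_verts)

lemmas with_proj_walk = cas_with_proj_eq awalk_verts_with_proj_eq

text \<open>A vertex list zipped with its shift is the arc list of the walk through it; this turns
  the vertex-list cycles of \<open>no_cycle\<close> into the arc-list cycles of
  \<open>cycle\<close>.\<close>

lemma walk_zip_tl:
  "pcas x (zip (x # ys) (ys @ [z])) z"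
  "pawalk_verts x (zip (x # ys) (ys @ [z])) = x # ys @ [z]"
  by (induction ys arbitrary: x) auto

lemma zip_tl_arcs:
  "successively (\<lambda>x y. (x, y) \<in> E) (x # ys) \<Longrightarrow> (last (x # ys), z) \<in> E \<Longrightarrow>
    set (zip (x # ys) (ys @ [z])) \<subseteq> E"
  by (induction ys arbitrary: x) auto

lemma undirected_tree_no_cycle:
  assumes "undirected_tree T"
  shows "no_cycle (parcs T) (pverts T)"
  unfolding no_cycle_def
proof
  assume "\<exists>xs. distinct xs \<and> 3 \<le> length xs \<and> set xs \<subseteq> pverts T \<and>
     successively (\<lambda>x y. (x, y) \<in> parcs T) xs \<and> (last xs, hd xs) \<in> parcs T"
  then obtain xs where xs: "distinct xs" "3 \<le> length xs" "set xs \<subseteq> pverts T"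
     "successively (\<lambda>x y. (x, y) \<in> parcs T) xs" "(last xs, hd xs) \<in> parcs T" by blast
  obtain x ys where xy: "xs = x # ys" using xs(2) by (cases xs) auto
  let ?p = "zip (x # ys) (ys @ [x])"
  have "pre_digraph.awalk (with_proj T) x ?p x"
    unfolding pre_digraph.awalk_def using walk_zip_tl(1)[of x ys x] zip_tl_arcs[of "parcs T" x ys x] xs
    by (simp add: xy with_proj_walk del: zip_Cons1 zip_Cons_Cons)
  moreover have "distinct (tl (pre_digraph.awalk_verts (with_proj T) x ?p))"
    using walk_zip_tl(2)[of x ys x] xs(1) by (simp add: xy with_proj_walk del: zip_Cons1 zip_Cons_Cons)
  ultimately have "pre_digraph.cycle (with_proj T) ?p"
    unfolding pre_digraph.cycle_def by (intro exI[of _ x] conjI) auto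
  moreover have "3 \<le> length ?p" using xs(2) by (simp add: xy)
  ultimately show False using assms unfolding undirected_tree_def by blast
qed

section \<open>Trees given by a parent map\<close>

definition parent_tree :: "'n set \<Rightarrow> 'n \<Rightarrow> ('n \<Rightarrow> 'n) \<Rightarrow> 'n pair_pre_digraph" where
  "parent_tree V r \<pi> =
     \<lparr>pverts = V, parcs = (\<lambda>u. (u, \<pi> u)) ` (V - {r}) \<union> (\<lambda>u. (\<pi> u, u)) ` (V - {r})\<rparr>"

lemma pcas_nth:
  "pcas u p v \<Longrightarrow> i < length p \<Longrightarrow> fst (p ! i) = (if i = 0 then u else snd (p ! (i - 1)))"
proof (induction u p v arbitrary: i rule: pcas.induct)
  case (2 u e es v)
  then show ?case by (cases i) (auto simp: nth_Cons')
qed simp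

lemma pcas_last: "pcas u p v \<Longrightarrow> p \<noteq> [] \<Longrightarrow> snd (last p) = v"
  by (induction u p v rule: pcas.induct) auto

lemma pawalk_verts_pcas: "pcas u p v \<Longrightarrow> pawalk_verts u p = u # map snd p"
  by (induction u p v rule: pcas.induct) auto

text \<open>The potential \<open>h\<close> grows strictly towards the root, so iterating
  \<open>\<pi>\<close> always ends in \<open>r\<close>. In the application it is the size of the
  vertex set that a node is responsible for.\<close>

locale rooted_parent =
  fixes V :: "'n set" and r :: 'n and \<pi> :: "'n \<Rightarrow> 'n" and h :: "'n \<Rightarrow> nat"
  assumes finite_V: "finite V" and root: "r \<in> V"
    and parent: "u \<in> V \<Longrightarrow> u \<noteq> r \<Longrightarrow> \<pi> u \<in> V \<and> h u < h (\<pi> u)"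
begin

abbreviation "T \<equiv> parent_tree V r \<pi>"

lemma pverts_T [simp]: "pverts T = V"
  by (simp add: parent_tree_def)

lemma parcs_T_iff:
  "(a, b) \<in> parcs T \<longleftrightarrow> (a \<in> V \<and> a \<noteq> r \<and> b = \<pi> a) \<or> (b \<in> V \<and> b \<noteq> r \<and> a = \<pi> b)"
  by (auto simp: parent_tree_def)

lemma sym_parcs_T: "sym (parcs T)"
  by (auto simp: sym_def parcs_T_iff)

lemma pair_graph_T: "pair_graph T"
proof
  fix e assume "e \<in> parcs T"
  then show "fst e \<in> pverts T" "snd e \<in> pverts T" "fst e \<noteq> snd e"
    using parent by (cases e; force simp: parcs_T_iff)+
next
  show "finite (pverts T)" "finite (parcs T)" using finite_V by (auto simp: parent_tree_def)
  show "symmetric (with_proj T)" using sym_parcs_T by (simp add: symmetric_def)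
qed

text \<open>Every node of \<open>K\<close> climbs within \<open>K\<close> to \<open>t\<close>, and
  the climb ends because \<open>h\<close> is bounded on \<open>V\<close>. For the nodes whose bags
  hold a given vertex, \<open>t\<close> is the topmost one.\<close>

lemma connected_in_T:
  assumes "K \<subseteq> V" "t \<in> K" and up: "\<And>u. u \<in> K \<Longrightarrow> u \<noteq> t \<Longrightarrow> u \<noteq> r \<and> \<pi> u \<in> K"
  shows "connected_in (parcs T) K"
proof -
  let ?R = "parcs T \<inter> K \<times> K"
  have reach: "(u, t) \<in> ?R\<^sup>*" if "u \<in> K" for u
    using that
  proof (induction "Max (h ` V) - h u" arbitrary: u rule: less_induct)
    case less
    show ?case
    proof (cases "u = t")
      case False
      then have u: "u \<noteq> r" "\<pi> u \<in> K" "u \<in> V" using up less.prems assms(1) by auto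
      then have "h u < h (\<pi> u)" "h (\<pi> u) \<le> Max (h ` V)"
        using parent finite_V by auto
      then have "(\<pi> u, t) \<in> ?R\<^sup>*" using less.hyps[of "\<pi> u"] u(2) by linarith
      moreover have "(u, \<pi> u) \<in> ?R" using u less.prems by (simp add: parcs_T_iff)
      ultimately show ?thesis by (rule converse_rtrancl_into_rtrancl[rotated])
    qed simp
  qed
  have "sym (?R\<^sup>*)" using sym_parcs_T by (intro sym_rtrancl) (auto simp: sym_def)
  then show ?thesis unfolding connected_in_def using reach by (meson rtrancl_trans symD)
qed

text \<open>At a vertex \<open>x\<close> of a cycle where \<open>h\<close> is least, both cycle
  neighbours must be the parent of \<open>x\<close>, hence equal, against distinctness.\<close>

lemma no_long_cycle_T:
  assumes "pre_digraph.cycle (with_proj T) p" "3 \<le> length p"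
  shows False
proof -
  obtain u where cas: "pcas u p u" and arcs: "set p \<subseteq> parcs T" and dist: "distinct (map snd p)"
    using assms(1) unfolding pre_digraph.cycle_def pre_digraph.awalk_def
    by (auto simp: with_proj_walk pawalk_verts_pcas)
  let ?n = "length p"
  have prev: "fst (p ! i) = snd (p ! (if i = 0 then ?n - 1 else i - 1))" if "i < ?n" for i
    using pcas_nth[OF cas that] pcas_last[OF cas] that by (auto simp: last_conv_nth)
  obtain i where i: "i < ?n" and min: "\<And>j. j < ?n \<Longrightarrow> h (snd (p ! i)) \<le> h (snd (p ! j))"
    using ex_has_least_nat[of "\<lambda>i. i < ?n" 0 "\<lambda>i. h (snd (p ! i))"] assms(2) by fastforce
  define x where "x = snd (p ! i)"
  \<comment> \<open>Cyclic predecessor and successor of position \<open>i\<close>; they differ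
    because the length is at least 3.\<close>
  define j where "j = (if i = 0 then ?n - 1 else i - 1)"
  define l where "l = (if i = ?n - 1 then 0 else i + 1)"
  have jl: "j < ?n" "l < ?n" "j \<noteq> l" using i assms(2) by (auto simp: j_def l_def)
  have "(snd (p ! j), x) \<in> parcs T" using prev[OF i] nth_mem[OF i] arcs unfolding x_def j_def
    by (metis prod.collapse subsetD)
  then have "snd (p ! j) = \<pi> x" using min[OF jl(1)] parent
    unfolding parcs_T_iff x_def by fastforce
  moreover have "fst (p ! l) = x" using prev[OF jl(2)] i unfolding x_def l_def by auto
  then have "(x, snd (p ! l)) \<in> parcs T" using nth_mem[OF jl(2)] arcs
    by (metis prod.collapse subsetD)
  then have "snd (p ! l) = \<pi> x" using min[OF jl(2)] parent
    unfolding parcs_T_iff x_def by fastforce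
  ultimately show False using dist jl by (metis length_map nth_eq_iff_index_eq nth_map)
qed

lemma undirected_tree_T: "undirected_tree T"
  unfolding undirected_tree_def
proof (intro conjI)
  show "connected (with_proj T)"
    unfolding connected_with_proj_iff[OF sym_parcs_T]
    using connected_in_T[of V r] root parent by auto
qed (use pair_graph_T no_long_cycle_T in blast)+

text \<open>A path that cannot go up at its start \<open>a\<close> descends all the way: the first
  arc leads to a child \<open>b\<close>, whose parent \<open>a\<close> is then excluded by
  distinctness. The fourth premise is this invariant, and a path from the root satisfies it.\<close>

lemma walk_down:
  assumes "pcas a p w" "set p \<subseteq> parcs T" "distinct (pawalk_verts a p)"
    and "a = r \<or> \<pi> a \<notin> set (pawalk_verts a p)" "u \<in> set (pawalk_verts a p)"
  shows "(w, u) \<in> ((\<lambda>x. (x, \<pi> x)) ` (V - {r}))\<^sup>*"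
  using assms
proof (induction a p w arbitrary: u rule: pcas.induct)
  case (2 a e es w)
  obtain b where e: "e = (a, b)" using 2(2) by (cases e) auto
  have b: "b \<in> set (pawalk_verts b es)" using 2(2) by (auto simp: pawalk_verts_pcas e)
  have ab: "b \<in> V" "b \<noteq> r" "a = \<pi> b"
    using 2(3,5) b by (auto simp: e parcs_T_iff)
  have IH: "(w, v) \<in> ((\<lambda>x. (x, \<pi> x)) ` (V - {r}))\<^sup>*" if "v \<in> set (pawalk_verts b es)" for v
    using 2(1)[of v] 2(2-4) ab that by (auto simp: e)
  show ?case
  proof (cases "u = a")
    case True
    have "(b, a) \<in> (\<lambda>x. (x, \<pi> x)) ` (V - {r})" using ab by auto
    then show ?thesis using IH[OF b] True by (auto intro: rtrancl.rtrancl_into_rtrancl)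
  next
    case False
    then show ?thesis using IH[of u] 2(6) by (auto simp: e)
  qed
qed simp

lemma rooted_subtree_T:
  assumes "w \<in> rooted_subtree T r u"
  shows "(w, u) \<in> ((\<lambda>x. (x, \<pi> x)) ` (V - {r}))\<^sup>*"
  using assms walk_down[of r _ w u]
  unfolding rooted_subtree_def pre_digraph.apath_def pre_digraph.awalk_def by (auto simp: with_proj_walk)

end

section \<open>VC dimension and integral covers\<close>

definition shatters :: "'b set set \<Rightarrow> 'b set \<Rightarrow> bool" where
  "shatters \<A> S \<longleftrightarrow> (\<forall>B\<subseteq>S. \<exists>A\<in>\<A>. A \<inter> S = B)"

lemma shattersE:
  assumes "shatters \<A> S" "B \<subseteq> S"
  obtains A where "A \<in> \<A>" "A \<inter> S = B"
  using assms unfolding shatters_def by blast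

lemma shatters_mono: "shatters \<A> S \<Longrightarrow> \<A> \<subseteq> \<B> \<Longrightarrow> shatters \<B> S"
  unfolding shatters_def by (meson subsetD)

text \<open>Pajor's form, by splitting \<open>\<A>\<close> at a point \<open>x\<close>. A set
  shattered by one of \<open>A0\<close>, \<open>A1\<close> is shattered by \<open>\<A>\<close>, and
  a set \<open>S\<close> shattered by both yields the further shattered set
  \<open>insert x S\<close>, which pays for its being counted twice.\<close>

theorem sauer_shelah_pajor:
  assumes "finite X" "\<A> \<subseteq> Pow X"
  shows "card \<A> \<le> card {S. S \<subseteq> X \<and> shatters \<A> S}"
  using assms
proof (induction X arbitrary: \<A> rule: finite_induct)
  case empty
  then consider "\<A> = {}" | "\<A> = {{}}" by (auto simp: subset_singleton_iff)
  then show ?case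
  proof cases
    case 2
    then have "{S. S \<subseteq> {} \<and> shatters \<A> S} = {{}}" by (auto simp: shatters_def)
    then show ?thesis using 2 by simp
  qed simp
next
  case (insert x X)
  define A0 where "A0 = {A \<in> \<A>. x \<notin> A}"
  define A1 where "A1 = (\<lambda>A. A - {x}) ` {A \<in> \<A>. x \<in> A}"
  define S0 where "S0 = {S. S \<subseteq> X \<and> shatters A0 S}"
  define S1 where "S1 = {S. S \<subseteq> X \<and> shatters A1 S}"
  define S where "S = {S. S \<subseteq> insert x X \<and> shatters \<A> S}"
  have fin: "finite \<A>" using insert by (meson finite_Pow_iff finite_insert finite_subset)
  have finS: "finite S0" "finite S1" "finite S"
    unfolding S0_def S1_def S_def using insert(1) by (auto intro: finite_subset[of _ "Pow (insert x X)"])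
  have "inj_on (\<lambda>A. A - {x}) {A \<in> \<A>. x \<in> A}" by (auto simp: inj_on_def)
  then have "card {A \<in> \<A>. x \<in> A} = card A1" by (simp add: A1_def card_image)
  moreover have "\<A> = A0 \<union> {A \<in> \<A>. x \<in> A}" "A0 \<inter> {A \<in> \<A>. x \<in> A} = {}" by (auto simp: A0_def)
  ultimately have "card \<A> = card A0 + card A1"
    using fin by (metis (no_types, lifting) card_Un_disjoint finite_Un)
  also have "\<dots> \<le> card S0 + card S1"
    unfolding S0_def S1_def using insert.prems
    by (intro add_mono insert.IH) (auto simp: A0_def A1_def)
  also have "\<dots> = card (S0 \<union> S1) + card (S0 \<inter> S1)"
    by (rule card_Un_Int) (use finS in auto)
  also have "card (S0 \<inter> S1) = card (Set.insert x ` (S0 \<inter> S1))"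
    by (rule card_image[symmetric], rule inj_onI) (use insert(2) in \<open>auto simp: S0_def\<close>)
  also have "card (S0 \<union> S1) + \<dots> = card ((S0 \<union> S1) \<union> Set.insert x ` (S0 \<inter> S1))"
    by (rule card_Un_disjoint[symmetric]) (use finS insert(2) in \<open>auto simp: S0_def S1_def\<close>)
  also have "\<dots> \<le> card S"
  proof (rule card_mono[OF finS(3)], intro subsetI)
    fix Y assume "Y \<in> S0 \<union> S1 \<union> Set.insert x ` (S0 \<inter> S1)"
    then consider "Y \<in> S0" | "Y \<in> S1" | Z where "Y = Set.insert x Z" "Z \<in> S0" "Z \<in> S1" by auto
    then show "Y \<in> S"
    proof cases
      case 1
      then show ?thesis using shatters_mono[of A0 Y \<A>] by (auto simp: S0_def S_def A0_def)
    next
      case 2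
      then have Y: "x \<notin> Y" "Y \<subseteq> X" "shatters A1 Y" using insert(2) by (auto simp: S1_def)
      have "\<exists>A\<in>\<A>. A \<inter> Y = B" if B: "B \<subseteq> Y" for B
      proof -
        obtain A where "A \<in> \<A>" "(A - {x}) \<inter> Y = B"
          using shattersE[OF Y(3) B] by (auto simp: A1_def)
        then show ?thesis using Y(1) by (intro bexI[of _ A]) auto
      qed
      then show ?thesis using Y(2) by (auto simp: S_def shatters_def)
    next
      case 3
      have Z: "Z \<subseteq> X" "x \<notin> Z" using 3 insert(2) by (auto simp: S0_def)
      have "\<exists>A\<in>\<A>. A \<inter> Y = B" if "B \<subseteq> Y" for B
      proof (cases "x \<in> B")
        case True
        then have "B - {x} \<subseteq> Z" using that 3 by auto
        moreover have "shatters A1 Z" using 3(3) by (simp add: S1_def)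
        ultimately obtain A' where "A' \<in> A1" "A' \<inter> Z = B - {x}" by (meson shattersE)
        then obtain A where "A \<in> \<A>" "x \<in> A" "(A - {x}) \<inter> Z = B - {x}" by (auto simp: A1_def)
        then have "A \<inter> Y = B" using True Z 3(1) by auto
        then show ?thesis using \<open>A \<in> \<A>\<close> by blast
      next
        case False
        then have "B \<subseteq> Z" using that 3 by auto
        moreover have "shatters A0 Z" using 3(2) by (simp add: S0_def)
        ultimately obtain A where "A \<in> A0" "A \<inter> Z = B" by (meson shattersE)
        then have "A \<in> \<A>" "x \<notin> A" "A \<inter> Z = B" by (auto simp: A0_def)
        then have "A \<inter> Y = B" using 3(1) by auto
        then show ?thesis using \<open>A \<in> \<A>\<close> by blast
      qed
      then show ?thesis using Z 3 unfolding S_def shatters_def by auto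
    qed
  qed
  finally show ?case unfolding S_def .
qed

text \<open>Shattered sets have one of \<open>D\<close> sizes, and each size contributes at most
  \<open>card X ^ D\<close>. This crude bound suffices, as the epsilon-net argument sets a
  polynomial against an exponential.\<close>

corollary sauer_shelah_bound:
  assumes "finite X" "X \<noteq> {}" "\<A> \<subseteq> Pow X"
    and vc: "\<And>S. S \<subseteq> X \<Longrightarrow> shatters \<A> S \<Longrightarrow> card S < D"
  shows "card \<A> \<le> D * card X ^ D"
proof -
  have pos: "card X \<ge> 1" using assms by (simp add: Suc_leI card_gt_0_iff)
  have "card \<A> \<le> card {S. S \<subseteq> X \<and> shatters \<A> S}"
    by (rule sauer_shelah_pajor) fact+
  also have "\<dots> \<le> card (\<Union>k<D. {S. S \<subseteq> X \<and> card S = k})"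
    by (rule card_mono) (use assms(1) vc in auto)
  also have "\<dots> \<le> (\<Sum>k<D. card {S. S \<subseteq> X \<and> card S = k})"
    by (rule card_UN_le) simp
  also have "\<dots> \<le> (\<Sum>k<D. card X ^ D)"
  proof (rule sum_mono)
    fix k assume "k \<in> {..<D}"
    have "card {S. S \<subseteq> X \<and> card S = k} = card X choose k" by (rule n_subsets) fact
    also have "\<dots> \<le> card X ^ k"
      by (cases "k \<le> card X") (auto simp: binomial_le_pow binomial_eq_0)
    also have "\<dots> \<le> card X ^ D" using \<open>k \<in> _\<close> pos by (intro power_increasing) auto
    finally show "card {S. S \<subseteq> X \<and> card S = k} \<le> card X ^ D" .
  qed
  finally show ?thesis by simp
qed

section \<open>Product measures and epsilon-nets\<close>

lemma sum_PiE_insert: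
  assumes "j \<notin> J"
  shows "sum f (PiE (insert j J) (\<lambda>_. E)) = (\<Sum>g\<in>PiE J (\<lambda>_. E). \<Sum>y\<in>E. f (g(j := y)))"
proof -
  have "sum f (PiE (insert j J) (\<lambda>_. E)) = (\<Sum>(y, g)\<in>E \<times> PiE J (\<lambda>_. E). f (g(j := y)))"
    unfolding PiE_insert_eq
    by (subst sum.reindex[OF inj_combinator[OF assms]]) (simp add: case_prod_unfold)
  also have "\<dots> = (\<Sum>y\<in>E. \<Sum>g\<in>PiE J (\<lambda>_. E). f (g(j := y)))"
    by (rule sum.cartesian_product[symmetric])
  finally show ?thesis by (simp add: sum.swap[of _ E])
qed

lemma sum_PiE_prod_eq_1:
  fixes p :: "'e \<Rightarrow> real"
  assumes "finite J" "sum p E = 1"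
  shows "(\<Sum>x\<in>PiE J (\<lambda>_. E). \<Prod>j\<in>J. p (x j)) = 1"
  using assms(1)
proof (induction J rule: finite_induct)
  case (insert j J)
  have "(\<Prod>i\<in>insert j J. p ((g(j := y)) i)) = p y * (\<Prod>i\<in>J. p (g i))" for g y
    by (subst prod.insert) (use insert in \<open>auto intro!: prod.cong\<close>)
  then show ?case
    unfolding sum_PiE_insert[OF insert(2)] using insert(3) by (simp add: assms(2) flip: sum_distrib_right)
qed simp

text \<open>Once all coordinates except \<open>j\<close> are fixed, \<open>A x\<close> is a fixed
  set of mass at least \<open>\<epsilon>\<close> and \<open>x j\<close> is still a fresh draw, so
  the bound holds conditionally and hence on average.\<close>

lemma sample_hits_independent_set:
  fixes p :: "'e \<Rightarrow> real"
  assumes "finite J" "j \<in> J" "sum p E = 1" "finite E" "\<And>e. e \<in> E \<Longrightarrow> 0 \<le> p e"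
    and indep: "\<And>x y. A (x(j := y)) = A x"
    and heavy: "\<And>x. A x \<subseteq> E \<and> \<epsilon> \<le> sum p (A x)"
  shows "\<epsilon> \<le> (\<Sum>x\<in>PiE J (\<lambda>_. E). (\<Prod>i\<in>J. p (x i)) * of_bool (x j \<in> A x))"
proof -
  let ?J = "J - {j}"
  have J: "J = insert j ?J" using assms(2) by auto
  have pr: "(\<Prod>i\<in>J. p ((g(j := y)) i)) = p y * (\<Prod>i\<in>?J. p (g i))" for g y
    by (subst J, subst prod.insert) (use assms(1) in \<open>auto intro!: prod.cong\<close>)
  have w: "0 \<le> (\<Prod>i\<in>?J. p (g i))" if "g \<in> PiE ?J (\<lambda>_. E)" for g
    using that assms(5) by (intro prod_nonneg) auto
  have "\<epsilon> = (\<Sum>g\<in>PiE ?J (\<lambda>_. E). (\<Prod>i\<in>?J. p (g i)) * \<epsilon>)"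
    using sum_PiE_prod_eq_1[of ?J p E] assms(1,3) by (simp flip: sum_distrib_right)
  also have "\<dots> \<le> (\<Sum>g\<in>PiE ?J (\<lambda>_. E). (\<Prod>i\<in>?J. p (g i)) * sum p (A g))"
    by (intro sum_mono mult_left_mono) (use heavy w in auto)
  also have "\<dots> = (\<Sum>g\<in>PiE ?J (\<lambda>_. E). \<Sum>y\<in>E. (\<Prod>i\<in>J. p ((g(j := y)) i)) * of_bool ((g(j := y)) j \<in> A (g(j := y))))"
  proof (rule sum.cong[OF refl])
    fix g assume "g \<in> PiE ?J (\<lambda>_. E)"
    have "sum p (A g) = (\<Sum>y\<in>E. p y * of_bool (y \<in> A g))"
      by (simp add: of_bool_def if_distrib sum.inter_restrict[OF assms(4), symmetric]
            Int_absorb1[OF heavy[THEN conjunct1]] cong: if_cong)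
    then show "(\<Prod>i\<in>?J. p (g i)) * sum p (A g) =
        (\<Sum>y\<in>E. (\<Prod>i\<in>J. p ((g(j := y)) i)) * of_bool ((g(j := y)) j \<in> A (g(j := y))))"
      unfolding pr indep by (simp add: sum_distrib_left mult_ac)
  qed
  also have "\<dots> = (\<Sum>x\<in>PiE J (\<lambda>_. E). (\<Prod>i\<in>J. p (x i)) * of_bool (x j \<in> A x))"
    by (subst (4) J, subst sum_PiE_insert) simp_all
  finally show ?thesis .
qed

text \<open>Indices carrying the same point lie in the same traces, so a shattered index set selects
  distinct points. Samples may thus contain repetitions without raising the VC dimension.\<close>

lemma shatters_trace:
  assumes "S \<subseteq> J" and sh: "shatters ((\<lambda>A. {j \<in> J. x j \<in> A}) ` \<A>) S"
  shows "shatters \<A> (x ` S) \<and> card (x ` S) = card S"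
proof
  have inj: "inj_on x S"
  proof (rule inj_onI)
    fix a b assume ab: "a \<in> S" "b \<in> S" "x a = x b"
    obtain A where A: "{j \<in> J. x j \<in> A} \<inter> S = {a}"
      using sh ab(1) unfolding shatters_def by (metis (no_types, lifting) empty_subsetI imageE insert_subset)
    then have "x a \<in> A" by blast
    then have "b \<in> {j \<in> J. x j \<in> A} \<inter> S" using ab assms(1) by auto
    then show "a = b" using A by simp
  qed
  then show "card (x ` S) = card S" by (rule card_image)
  show "shatters \<A> (x ` S)"
    unfolding shatters_def
  proof (intro allI impI)
    fix B assume B: "B \<subseteq> x ` S"
    have "{j \<in> S. x j \<in> B} \<subseteq> S" by auto
    then obtain A where A: "A \<in> \<A>" "{j \<in> J. x j \<in> A} \<inter> S = {j \<in> S. x j \<in> B}"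
      using sh unfolding shatters_def by blast
    have "A \<inter> x ` S = B" using A(2) B assms(1) by auto
    then show "\<exists>A\<in>\<A>. A \<inter> x ` S = B" using A(1) by blast
  qed
qed

text \<open>
  Haussler and Welzl's theorem by a first-moment count. If no \<open>m\<close> points hit \<open>\<A>\<close>, then for a
  random sample \<open>x\<close> of \<open>2m\<close> points every index tuple \<open>i\<close> of length \<open>m\<close> selects a member of \<open>\<A>\<close>
  missing \<open>x \<circ> i\<close>. On average its trace \<open>Z x i\<close> contains at least \<open>\<epsilon>m\<close> of the sample indices,
  whereas a trace with more than \<open>\<epsilon>m/2\<close> indices is avoided by at most a fraction
  \<open>(1 - \<epsilon>/4)\<^sup>m\<close> of all tuples. This forces exponentially many traces, against Sauer-Shelah.
\<close>

theorem epsilon_net: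
  fixes p :: "'e \<Rightarrow> real"
  assumes "finite E" and p: "\<And>e. e \<in> E \<Longrightarrow> 0 \<le> p e" "sum p E = 1"
    and heavy: "\<And>A. A \<in> \<A> \<Longrightarrow> A \<subseteq> E \<and> \<epsilon> \<le> sum p A"
    and vc: "\<And>S. S \<subseteq> E \<Longrightarrow> shatters \<A> S \<Longrightarrow> card S < D"
    and eps: "0 < \<epsilon>" "\<epsilon> \<le> 1" and m: "1 \<le> m"
    and large: "real D * real (2 * m) ^ D * (1 - \<epsilon> / 4) ^ m < \<epsilon> / 4"
  shows "\<exists>N\<subseteq>E. card N \<le> m \<and> (\<forall>A\<in>\<A>. A \<inter> N \<noteq> {})"
proof (rule ccontr)
  assume "\<not> ?thesis"
  \<comment> \<open>For \<open>N\<close> too large or not within \<open>E\<close> any member of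
    \<open>\<A>\<close> will do; the instance \<open>N = {}\<close> of the assumption provides
    one.\<close>
  then have "\<exists>A\<in>\<A>. N \<subseteq> E \<longrightarrow> card N \<le> m \<longrightarrow> A \<inter> N = {}" for N
    by (metis card.empty empty_subsetI le0)
  then obtain F where F: "\<And>N. F N \<in> \<A>" "\<And>N. N \<subseteq> E \<Longrightarrow> card N \<le> m \<Longrightarrow> F N \<inter> N = {}"
    by metis
  define J where "J = {..<2 * m}"
  define X where "X = PiE J (\<lambda>_. E)"
  define I where "I = PiE {..<m} (\<lambda>_. J)"
  define G where "G x i = F (x ` i ` {..<m})" for x :: "nat \<Rightarrow> 'e" and i
  define Z where "Z x i = {j \<in> J. x j \<in> G x i}" for x i
  define w where "w x = (\<Prod>j\<in>J. p (x j))" for x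
  have finJ: "finite J" and cardJ: "card J = 2 * m" by (auto simp: J_def)
  have finX: "finite X" unfolding X_def using finJ assms(1) by (auto intro: finite_PiE)
  have finI: "finite I" unfolding I_def using finJ by (auto intro: finite_PiE)
  have cardI: "card I = (2 * m) ^ m" unfolding I_def by (simp add: card_PiE cardJ)
  have w_nonneg: "0 \<le> w x" if "x \<in> X" for x
    unfolding w_def using that p(1) by (intro prod_nonneg) (auto simp: X_def)
  have w1: "sum w X = 1" unfolding w_def X_def by (rule sum_PiE_prod_eq_1) fact+
  have ZJ: "Z x i \<subseteq> J" for x i by (auto simp: Z_def)
  have avg: "\<epsilon> * m \<le> (\<Sum>x\<in>X. w x * card (Z x i))" if i: "i \<in> I" for i
  proof -
    \<comment> \<open>At least \<open>m\<close> of the \<open>2m\<close> indices are not selected by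
      \<open>i\<close>. As \<open>G x i\<close> ignores these coordinates of \<open>x\<close>, each
      of them is an independent draw against it.\<close>
    let ?K = "J - i ` {..<m}"
    have "m \<le> card ?K"
    proof -
      have "card (i ` {..<m}) \<le> m" using card_image_le[of "{..<m}" i] by simp
      then show ?thesis using diff_card_le_card_Diff[of "i ` {..<m}" J] cardJ by simp
    qed
    then have "\<epsilon> * m \<le> (\<Sum>j\<in>?K. \<epsilon>)" using eps by (simp add: mult.commute)
    also have "\<dots> \<le> (\<Sum>j\<in>?K. \<Sum>x\<in>X. w x * of_bool (x j \<in> G x i))"
    proof (rule sum_mono)
      fix j assume j: "j \<in> ?K"
      have "G (x(j := y)) i = G x i" for x y
      proof -
        have "(x(j := y)) ` i ` {..<m} = x ` i ` {..<m}" using j by (intro image_cong) auto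
        then show ?thesis by (simp add: G_def)
      qed
      then show "\<epsilon> \<le> (\<Sum>x\<in>X. w x * of_bool (x j \<in> G x i))"
        unfolding w_def X_def
        by (intro sample_hits_independent_set) (use j finJ p assms(1) heavy F in \<open>auto simp: G_def\<close>)
    qed
    also have "\<dots> \<le> (\<Sum>j\<in>J. \<Sum>x\<in>X. w x * of_bool (x j \<in> G x i))"
      by (rule sum_mono2) (use finJ w_nonneg in \<open>auto intro!: sum_nonneg\<close>)
    also have "\<dots> = (\<Sum>x\<in>X. w x * card (Z x i))"
    proof (subst sum.swap, rule sum.cong[OF refl])
      fix x
      have "(\<Sum>j\<in>J. of_bool (x j \<in> G x i)) = real (card (Z x i))"
        unfolding Z_def using finJ by (simp add: sum.If_cases of_bool_def Int_def conj_commute)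
      then show "(\<Sum>j\<in>J. w x * of_bool (x j \<in> G x i)) = w x * card (Z x i)"
        by (simp flip: sum_distrib_left)
    qed
    finally show ?thesis .
  qed
  have "\<exists>x\<in>X. card I * (\<epsilon> * m) \<le> (\<Sum>i\<in>I. real (card (Z x i)))"
  proof (rule ccontr)
    assume "\<not> ?thesis"
    then have less: "(\<Sum>i\<in>I. real (card (Z x i))) < card I * (\<epsilon> * m)" if "x \<in> X" for x
      using that by (meson not_le)
    obtain y where y: "y \<in> X" "0 < w y"
      using w1 w_nonneg by (metis less_eq_real_def sum.neutral zero_neq_one)
    have "(\<Sum>i\<in>I. \<epsilon> * m) \<le> (\<Sum>i\<in>I. \<Sum>x\<in>X. w x * card (Z x i))"
      by (intro sum_mono avg)
    also have "\<dots> = (\<Sum>x\<in>X. w x * (\<Sum>i\<in>I. real (card (Z x i))))"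
      by (subst sum.swap) (simp add: sum_distrib_left)
    also have "\<dots> < (\<Sum>x\<in>X. w x * (card I * (\<epsilon> * m)))"
      by (rule sum_strict_mono_strong[OF finX y(1)])
        (use less[OF y(1)] y(2) in \<open>auto intro!: mult_left_mono less_imp_le[OF less] w_nonneg\<close>)
    also have "\<dots> = card I * (\<epsilon> * m)" using w1 by (simp flip: sum_distrib_right)
    finally show False by simp
  qed
  then obtain x where x: "x \<in> X" and xavg: "card I * (\<epsilon> * m) \<le> (\<Sum>i\<in>I. real (card (Z x i)))"
    by blast
  define \<T> where "\<T> = (\<lambda>A. {j \<in> J. x j \<in> A}) ` \<A>"
  have Z\<T>: "Z x i \<in> \<T>" for i unfolding \<T>_def Z_def G_def using F(1) by auto
  have \<T>J: "\<T> \<subseteq> Pow J" by (auto simp: \<T>_def)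
  then have fin\<T>: "finite \<T>" using finJ by (meson finite_Pow_iff finite_subset)
  have card\<T>: "card \<T> \<le> D * (2 * m) ^ D"
    unfolding cardJ[symmetric]
  proof (rule sauer_shelah_bound[OF finJ _ \<T>J])
    show "J \<noteq> {}" using m cardJ by auto
    fix S assume S: "S \<subseteq> J" "shatters \<T> S"
    have "x ` S \<subseteq> E" using x S(1) by (auto simp: X_def)
    then show "card S < D" using shatters_trace[of S J x \<A>] S vc[of "x ` S"] by (auto simp: \<T>_def)
  qed
  \<comment> \<open>A trace has at most \<open>2m\<close> indices, so an average of
    \<open>\<epsilon>m\<close> leaves at least the fraction
    \<open>(\<epsilon>m - \<epsilon>m/2) / (2m) = \<epsilon>/4\<close> of the tuples with a trace
    above half that average.\<close>
  define L where "L = {i \<in> I. \<epsilon> * m / 2 < card (Z x i)}"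
  have "card I * (\<epsilon> * m) \<le> (\<Sum>i\<in>I. \<epsilon> * m / 2 + 2 * m * of_bool (i \<in> L))"
  proof (rule order_trans[OF xavg], rule sum_mono)
    fix i assume "i \<in> I"
    have "card (Z x i) \<le> 2 * m" using card_mono[OF finJ ZJ] cardJ by simp
    then show "real (card (Z x i)) \<le> \<epsilon> * m / 2 + 2 * m * of_bool (i \<in> L)"
      using \<open>i \<in> I\<close> eps by (auto simp: L_def of_nat_mono intro: add_increasing)
  qed
  also have "\<dots> = card I * (\<epsilon> * m / 2) + 2 * m * card L"
  proof -
    have "(\<Sum>i\<in>I. of_bool (i \<in> L)) = real (card L)"
      unfolding L_def using finI by (simp add: sum.If_cases of_bool_def Int_def conj_commute)
    then show ?thesis by (simp add: sum.distrib flip: sum_distrib_left)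
  qed
  finally have "real m * (card I * (\<epsilon> / 4)) \<le> real m * card L" by (simp add: algebra_simps)
  then have L_ge: "card I * (\<epsilon> / 4) \<le> card L" using m by simp
  have "L \<subseteq> (\<Union>T\<in>{T \<in> \<T>. \<epsilon> * m / 2 < card T}. PiE {..<m} (\<lambda>_. J - T))"
  proof
    fix i assume i: "i \<in> L"
    have "i k \<in> J - Z x i" if "k < m" for k
    proof -
      have iI: "i \<in> I" using i by (simp add: L_def)
      have "card (x ` i ` {..<m}) \<le> m"
        by (metis card_image_le card_lessThan finite_imageI finite_lessThan order_trans)
      moreover have "x ` i ` {..<m} \<subseteq> E" using x iI by (force simp: X_def I_def)
      ultimately have "G x i \<inter> x ` i ` {..<m} = {}" unfolding G_def using F(2) by blast
      then have "x (i k) \<notin> G x i" using that by auto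
      then show ?thesis using iI that by (auto simp: I_def Z_def)
    qed
    then have "i \<in> PiE {..<m} (\<lambda>_. J - Z x i)" using i by (auto simp: L_def I_def PiE_iff)
    then show "i \<in> (\<Union>T\<in>{T \<in> \<T>. \<epsilon> * m / 2 < card T}. PiE {..<m} (\<lambda>_. J - T))"
      using i Z\<T>[of i] by (auto simp: L_def)
  qed
  then have "card L \<le> card (\<Union>T\<in>{T \<in> \<T>. \<epsilon> * m / 2 < card T}. PiE {..<m} (\<lambda>_. J - T))"
    by (rule card_mono[rotated]) (use fin\<T> finJ in \<open>auto intro!: finite_PiE\<close>)
  also have "\<dots> \<le> (\<Sum>T\<in>{T \<in> \<T>. \<epsilon> * m / 2 < card T}. card (PiE {..<m} (\<lambda>_. J - T)))"
    by (rule card_UN_le) (use fin\<T> in auto)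
  finally have "real (card L) \<le> (\<Sum>T\<in>{T \<in> \<T>. \<epsilon> * m / 2 < card T}. real (card (PiE {..<m} (\<lambda>_. J - T))))"
    by (simp only: of_nat_sum[symmetric] of_nat_le_iff)
  also have "\<dots> \<le> (\<Sum>T\<in>{T \<in> \<T>. \<epsilon> * m / 2 < card T}. (2 * m * (1 - \<epsilon> / 4)) ^ m)"
  proof (rule sum_mono)
    fix T assume T: "T \<in> {T \<in> \<T>. \<epsilon> * m / 2 < card T}"
    then have "T \<subseteq> J" using \<T>J by auto
    then have "card (J - T) = 2 * m - card T" "card T \<le> 2 * m"
      using finJ cardJ by (simp_all add: card_Diff_subset finite_subset) (metis card_mono)
    then have "real (card (J - T)) \<le> 2 * m * (1 - \<epsilon> / 4)"
      using T by (simp add: of_nat_diff algebra_simps)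
    then show "real (card (PiE {..<m} (\<lambda>_. J - T))) \<le> (2 * m * (1 - \<epsilon> / 4)) ^ m"
      by (simp add: card_PiE power_mono)
  qed
  also have "\<dots> = card {T \<in> \<T>. \<epsilon> * m / 2 < card T} * (2 * m * (1 - \<epsilon> / 4)) ^ m" by simp
  also have "\<dots> \<le> card \<T> * (2 * m * (1 - \<epsilon> / 4)) ^ m"
    using eps by (intro mult_right_mono) (auto intro!: card_mono fin\<T>)
  also have "\<dots> \<le> (D * (2 * m) ^ D) * (2 * m * (1 - \<epsilon> / 4)) ^ m"
    by (intro mult_right_mono) (use eps of_nat_mono[OF card\<T>, where 'a = real] in auto)
  also have "\<dots> = card I * (real D * real (2 * m) ^ D * (1 - \<epsilon> / 4) ^ m)"
    by (simp add: cardI power_mult_distrib)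
  also have "\<dots> < card I * (\<epsilon> / 4)"
    using large m by (intro mult_strict_left_mono) (auto simp: cardI)
  finally show False using L_ge by simp
qed

lemma ex_sample_size:
  assumes "0 < \<epsilon>" "\<epsilon> \<le> (1 :: real)"
  shows "\<exists>m\<ge>1. real D * real (2 * m) ^ D * (1 - \<epsilon> / 4) ^ m < \<epsilon> / 4"
proof -
  \<comment> \<open>Since \<open>2m = (8 / \<epsilon>) * (\<epsilon> / 4 * m)\<close>, the factor
    \<open>(2m) ^ D\<close> is a constant times a power of the exponent in
    \<open>(1 - \<epsilon> / 4) ^ m \<le> exp (- (\<epsilon> / 4 * m))\<close>.\<close>
  let ?c = "real D * (8 / \<epsilon>) ^ D"
  have "filterlim (\<lambda>m. \<epsilon> / 4 * real m) at_top sequentially"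
    using assms by (intro filterlim_tendsto_pos_mult_at_top[OF tendsto_const] filterlim_real_sequentially) auto
  then have "(\<lambda>m. (\<epsilon> / 4 * real m) ^ D / exp (\<epsilon> / 4 * real m)) \<longlonglongrightarrow> 0"
    by (rule filterlim_compose[OF tendsto_power_div_exp_0])
  then have "(\<lambda>m. ?c * ((\<epsilon> / 4 * real m) ^ D / exp (\<epsilon> / 4 * real m))) \<longlonglongrightarrow> ?c * 0"
    by (intro tendsto_mult tendsto_const)
  then have "\<forall>\<^sub>F m in sequentially. ?c * ((\<epsilon> / 4 * real m) ^ D / exp (\<epsilon> / 4 * real m)) < \<epsilon> / 4"
    using assms by (intro order_tendstoD(2)) auto
  then obtain m where m: "m \<ge> 1" "?c * ((\<epsilon> / 4 * real m) ^ D / exp (\<epsilon> / 4 * real m)) < \<epsilon> / 4"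
    using eventually_happens'[OF sequentially_bot eventually_conj[OF eventually_ge_at_top[of 1]]] by blast
  have "(1 - \<epsilon> / 4) ^ m \<le> exp (- (\<epsilon> / 4)) ^ m"
    using assms exp_ge_add_one_self[of "- (\<epsilon> / 4)"] by (intro power_mono) auto
  also have "\<dots> = 1 / exp (\<epsilon> / 4 * real m)"
    by (simp only: exp_of_nat2_mult exp_minus power_inverse inverse_eq_divide power_one_over)
  finally have "real D * real (2 * m) ^ D * (1 - \<epsilon> / 4) ^ m
      \<le> real D * real (2 * m) ^ D * (1 / exp (\<epsilon> / 4 * real m))"
    by (intro mult_left_mono) auto
  also have "\<dots> = real D * (8 / \<epsilon> * (\<epsilon> / 4 * real m)) ^ D * (1 / exp (\<epsilon> / 4 * real m))"
    using assms by simp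
  also have "real D * (8 / \<epsilon> * (\<epsilon> / 4 * real m)) ^ D * (1 / exp (\<epsilon> / 4 * real m))
     = ?c * ((\<epsilon> / 4 * real m) ^ D / exp (\<epsilon> / 4 * real m))"
    by (simp only: power_mult_distrib times_divide_eq_right mult_1_right mult.assoc)
  finally have "real D * real (2 * m) ^ D * (1 - \<epsilon> / 4) ^ m
      \<le> ?c * ((\<epsilon> / 4 * real m) ^ D / exp (\<epsilon> / 4 * real m))" .
  then show ?thesis using m by (meson order_le_less_trans)
qed

section \<open>The dual set system of a hypergraph\<close>

text \<open>The set system dual to \<open>H\<close>: its points are the hyperedges of \<open>H\<close>.\<close>

definition edge_stars :: "'a hypergraph \<Rightarrow> 'a set set set" where
  "edge_stars H = (\<lambda>v. {e \<in> hedges H. v \<in> e}) ` hverts H"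

lemma hypergraph_finite_edges: "hypergraph H \<Longrightarrow> finite (hedges H)"
  unfolding hypergraph_def by (meson finite_Pow_iff finite_subset)

text \<open>The order of quantifiers is the point: \<open>k\<close> is a sample size determined by
  \<open>c\<close> and \<open>D\<close> alone, before \<open>H\<close>, \<open>X\<close> and
  \<open>\<gamma>\<close> are given.\<close>

lemma fractional_cover_imp_cover:
  fixes c :: real and D :: nat
  shows "\<exists>k. \<forall>(H :: 'a hypergraph) X \<gamma>. hypergraph H \<longrightarrow>
    (\<forall>S\<subseteq>hedges H. shatters (edge_stars H) S \<longrightarrow> card S < D) \<longrightarrow>
    fractional_edge_cover H X \<gamma> \<longrightarrow> X \<subseteq> hverts H \<longrightarrow> sum \<gamma> (hedges H) \<le> c \<longrightarrow>
    (\<exists>S\<subseteq>hedges H. card S \<le> k \<and> X \<subseteq> \<Union>S)"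
proof -
  \<comment> \<open>Using \<open>\<bar>c\<bar> + 1\<close> in place of \<open>c\<close> keeps
    \<open>\<epsilon>\<close> positive and at most 1 for every real \<open>c\<close>.\<close>
  define \<epsilon> where "\<epsilon> = 1 / (\<bar>c\<bar> + 1)"
  have eps: "0 < \<epsilon>" "\<epsilon> \<le> 1" by (auto simp: \<epsilon>_def)
  obtain m where m: "m \<ge> 1" "real D * real (2 * m) ^ D * (1 - \<epsilon> / 4) ^ m < \<epsilon> / 4"
    using ex_sample_size[OF eps] by blast
  show ?thesis
  proof (intro exI[of _ m] allI impI)
    fix H :: "'a hypergraph" and X \<gamma>
    assume H: "hypergraph H" and X: "X \<subseteq> hverts H"
      and vc: "\<forall>S\<subseteq>hedges H. shatters (edge_stars H) S \<longrightarrow> card S < D"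
      and \<gamma>: "fractional_edge_cover H X \<gamma>" "sum \<gamma> (hedges H) \<le> c"
    show "\<exists>S\<subseteq>hedges H. card S \<le> m \<and> X \<subseteq> \<Union>S"
    proof (cases "X = {}")
      \<comment> \<open>For empty \<open>X\<close> the cover may have weight 0 and could not be
        normalised. Otherwise a single star forces weight at least 1.\<close>
      case True
      then show ?thesis by (intro exI[of _ "{}"]) auto
    next
      case False
      let ?W = "sum \<gamma> (hedges H)"
      define p where "p e = \<gamma> e / ?W" for e
      define \<A> where "\<A> = (\<lambda>v. {e \<in> hedges H. v \<in> e}) ` X"
      have fin: "finite (hedges H)" using H by (rule hypergraph_finite_edges)
      have nn: "0 \<le> \<gamma> e" if "e \<in> hedges H" for e using \<gamma>(1) that by (simp add: fractional_edge_cover_def)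
      have star: "1 \<le> sum \<gamma> A" if "A \<in> \<A>" for A
        using \<gamma>(1) that unfolding fractional_edge_cover_def \<A>_def by auto
      have W: "1 \<le> ?W"
      proof -
        obtain A where A: "A \<in> \<A>" using False by (auto simp: \<A>_def)
        have "sum \<gamma> A \<le> ?W" by (rule sum_mono2) (use fin nn A in \<open>auto simp: \<A>_def\<close>)
        then show ?thesis using star[OF A] by simp
      qed
      have "\<epsilon> \<le> 1 / ?W" unfolding \<epsilon>_def using W \<gamma>(2) by (intro divide_left_mono) auto
      then have heavy: "A \<subseteq> hedges H \<and> \<epsilon> \<le> sum p A" if "A \<in> \<A>" for A
      proof -
        have "1 / ?W \<le> sum \<gamma> A / ?W" using star[OF that] W by (intro divide_right_mono) auto
        then have "\<epsilon> \<le> sum p A" using \<open>\<epsilon> \<le> 1 / ?W\<close> by (simp add: p_def sum_divide_distrib)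
        then show ?thesis using that by (auto simp: \<A>_def)
      qed
      have vc\<A>: "card S < D" if "S \<subseteq> hedges H" "shatters \<A> S" for S
      proof (rule vc[rule_format, OF that(1)])
        have "\<A> \<subseteq> edge_stars H" using X by (auto simp: \<A>_def edge_stars_def)
        then show "shatters (edge_stars H) S" by (rule shatters_mono[OF that(2)])
      qed
      have p1: "sum p (hedges H) = 1" using W by (simp add: p_def flip: sum_divide_distrib)
      have p0: "0 \<le> p e" if "e \<in> hedges H" for e using nn[OF that] W by (simp add: p_def)
      obtain N where N: "N \<subseteq> hedges H" "card N \<le> m" "\<And>A. A \<in> \<A> \<Longrightarrow> A \<inter> N \<noteq> {}"
        using epsilon_net[where \<A> = \<A>, OF fin p0 p1 heavy vc\<A> eps m] by auto
      have "X \<subseteq> \<Union>N"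
      proof
        fix v assume "v \<in> X"
        then have "{e \<in> hedges H. v \<in> e} \<inter> N \<noteq> {}" by (intro N(3)) (simp add: \<A>_def)
        then show "v \<in> \<Union>N" by blast
      qed
      then show ?thesis using N by blast
    qed
  qed
qed

text \<open>Label \<open>2 ^ n\<close> shattered hyperedges by the subsets of \<open>{..<n}\<close>.
  Shattering supplies for each \<open>i\<close> a vertex lying in exactly those whose label contains
  \<open>i\<close>, so the hyperedge labelled \<open>A\<close> cuts a copy of \<open>A\<close> out
  of these \<open>n\<close> vertices.\<close>

lemma not_exotic_imp_bounded_dual_vc:
  assumes no: "\<And>U. U \<subseteq> hverts H \<Longrightarrow> card U = n \<Longrightarrow>
      \<not> 2 ^ n - 1 \<le> card (hedges (induced_subhypergraph H U))"
    and S: "S \<subseteq> hedges H" "finite S" "shatters (edge_stars H) S"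
  shows "card S < 2 ^ n"
proof (rule ccontr)
  assume "\<not> card S < 2 ^ n"
  then obtain S' where S': "S' \<subseteq> S" "card S' = 2 ^ n" "finite S'"
    using obtain_subset_with_card_n[of "2 ^ n" S] by auto
  have "card (Pow {..<n}) = card S'" using S' by (simp add: card_Pow)
  then obtain b where b: "bij_betw b (Pow {..<n}) S'"
    using S'(3) finite_same_card_bij[of "Pow {..<n}" S'] by auto
  have "\<exists>v. v \<in> hverts H \<and> {e \<in> hedges H. v \<in> e} \<inter> S = b ` {A \<in> Pow {..<n}. i \<in> A}" for i
  proof -
    have "b ` {A \<in> Pow {..<n}. i \<in> A} \<subseteq> S" using b S'(1) by (auto simp: bij_betw_def)
    from shattersE[OF S(3) this] obtain A where "A \<in> edge_stars H"
      "A \<inter> S = b ` {A \<in> Pow {..<n}. i \<in> A}" .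
    then show ?thesis unfolding edge_stars_def by auto
  qed
  then have "\<exists>v. \<forall>i. v i \<in> hverts H \<and> {e \<in> hedges H. v i \<in> e} \<inter> S = b ` {A \<in> Pow {..<n}. i \<in> A}"
    by (intro choice allI)
  then obtain v where "\<forall>i. v i \<in> hverts H \<and> {e \<in> hedges H. v i \<in> e} \<inter> S = b ` {A \<in> Pow {..<n}. i \<in> A}" ..
  note v = this[THEN spec, THEN conjunct1] this[THEN spec, THEN conjunct2]
  have mem: "v i \<in> b A \<longleftrightarrow> i \<in> A" if "A \<subseteq> {..<n}" for i A
  proof -
    have bA: "b A \<in> S" using b that S'(1) by (auto simp: bij_betw_def)
    then have "v i \<in> b A \<longleftrightarrow> b A \<in> {e \<in> hedges H. v i \<in> e} \<inter> S" using S(1) by auto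
    also have "\<dots> \<longleftrightarrow> i \<in> A"
      unfolding v(2) using inj_on_image_mem_iff[of b "Pow {..<n}" A "{A \<in> Pow {..<n}. i \<in> A}"] b that
      by (simp add: bij_betw_def) blast
    finally show ?thesis .
  qed
  have inj: "inj_on v {..<n}"
  proof (rule inj_onI)
    fix i j assume ij: "i \<in> {..<n}" "j \<in> {..<n}" "v i = v j"
    have "v i \<in> b {i}" using mem[of "{i}" i] ij(1) by simp
    then have "v j \<in> b {i}" using ij(3) by simp
    then show "i = j" using mem[of "{i}" j] ij(1) by simp
  qed
  define U where "U = v ` {..<n}"
  have U: "U \<subseteq> hverts H" "card U = n" "finite U"
    using v(1) inj by (auto simp: U_def card_image)
  have "(\<lambda>A. v ` A) ` (Pow {..<n} - {{}}) \<subseteq> hedges (induced_subhypergraph H U)"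
  proof
    fix X assume "X \<in> (\<lambda>A. v ` A) ` (Pow {..<n} - {{}})"
    then obtain A where A: "A \<subseteq> {..<n}" "A \<noteq> {}" "X = v ` A" by auto
    have "b A \<inter> U = X" using mem[OF A(1)] A(1,3) by (auto simp: U_def)
    moreover have "b A \<in> hedges H" using b A(1) S'(1) S(1) by (auto simp: bij_betw_def)
    ultimately show "X \<in> hedges (induced_subhypergraph H U)"
      using A by (auto simp: induced_subhypergraph_def)
  qed
  moreover have "finite (hedges (induced_subhypergraph H U))"
    by (rule finite_subset[of _ "Pow U"]) (use U(3) in \<open>auto simp: induced_subhypergraph_def\<close>)
  ultimately have "card ((\<lambda>A. v ` A) ` (Pow {..<n} - {{}})) \<le> card (hedges (induced_subhypergraph H U))"
    by (intro card_mono)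
  moreover have "card ((\<lambda>A. v ` A) ` (Pow {..<n} - {{}})) = 2 ^ n - 1"
  proof -
    have "inj_on (\<lambda>A. v ` A) (Pow {..<n} - {{}})"
      by (rule inj_on_subset[OF inj_on_image_Pow[OF inj]]) auto
    then show ?thesis by (simp add: card_image card_Diff_subset card_Pow)
  qed
  ultimately show False using no[OF U(1,2)] by simp
qed

section \<open>Balanced separators and hypertree width\<close>

text \<open>Closed neighbourhood in the primal graph. The inclusion
  \<open>closed_nbhd E K \<subseteq> K \<union> \<Union>M\<close> says that \<open>M\<close> covers
  the boundary of \<open>K\<close>.\<close>

definition closed_nbhd :: "'a set set \<Rightarrow> 'a set \<Rightarrow> 'a set" where
  "closed_nbhd E K = K \<union> \<Union>{e \<in> E. e \<inter> K \<noteq> {}}"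

lemma closed_nbhd_mono: "K \<subseteq> K' \<Longrightarrow> closed_nbhd E K \<subseteq> closed_nbhd E K'"
  unfolding closed_nbhd_def by blast

lemma subset_closed_nbhd: "K \<subseteq> closed_nbhd E K"
  unfolding closed_nbhd_def by blast

lemma edge_subset_closed_nbhd: "e \<in> E \<Longrightarrow> e \<inter> K \<noteq> {} \<Longrightarrow> e \<subseteq> closed_nbhd E K"
  unfolding closed_nbhd_def by blast

text \<open>Balance counts the hyperedges of \<open>M\<close> that reach a block, not vertices,
  because these hyperedges are what the block inherits in the recursion.\<close>

definition balanced_separation ::
    "'a set \<Rightarrow> 'a set set \<Rightarrow> nat \<Rightarrow> 'a set set \<Rightarrow> 'a set set \<Rightarrow> 'a set set \<Rightarrow> bool" where
  "balanced_separation V E k M S P \<longleftrightarrow>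
     S \<subseteq> E \<and> card S \<le> k \<and> \<Union>P = V - \<Union>S \<and> disjoint P \<and>
     (\<forall>D\<in>P. \<forall>e\<in>E. e \<inter> D \<noteq> {} \<longrightarrow> e \<subseteq> D \<union> \<Union>S) \<and>
     (\<forall>D\<in>P. card {m \<in> M. m \<inter> D \<noteq> {}} \<le> k)"

definition adjacency :: "'a set set \<Rightarrow> 'a set \<Rightarrow> ('a \<times> 'a) set" where
  "adjacency E W = {(x, y). x \<in> W \<and> y \<in> W \<and> (\<exists>e\<in>E. x \<in> e \<and> y \<in> e)}"

definition component :: "'a set set \<Rightarrow> 'a set \<Rightarrow> 'a \<Rightarrow> 'a set" where
  "component E W x = (adjacency E W)\<^sup>* `` {x}"

lemma sym_adjacency: "sym ((adjacency E W)\<^sup>*)"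
  by (rule sym_rtrancl) (auto simp: sym_def adjacency_def)

lemma component_subset: "x \<in> W \<Longrightarrow> component E W x \<subseteq> W"
proof
  fix y assume x: "x \<in> W" and "y \<in> component E W x"
  then have "(x, y) \<in> (adjacency E W)\<^sup>*" by (simp add: component_def)
  then show "y \<in> W" by (induction rule: rtrancl_induct) (use x in \<open>auto simp: adjacency_def\<close>)
qed

lemma component_self: "x \<in> component E W x"
  by (simp add: component_def)

lemma component_reach:
  assumes "v \<in> component E W x" "w \<in> component E W x"
  shows "(v, w) \<in> (adjacency E W)\<^sup>*"
  using assms symD[OF sym_adjacency, of x v E W] by (auto simp: component_def intro: rtrancl_trans)

lemma component_eq:
  assumes "v \<in> component E W x" "v \<in> component E W y"
  shows "component E W x = component E W y"
proof -
  have "component E W a \<subseteq> component E W b" if "v \<in> component E W a" "v \<in> component E W b" for a b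
  proof
    fix w assume "w \<in> component E W a"
    then have "(v, w) \<in> (adjacency E W)\<^sup>*" by (rule component_reach[OF that(1)])
    then show "w \<in> component E W b" using that(2) by (auto simp: component_def intro: rtrancl_trans)
  qed
  then show ?thesis using assms by blast
qed

lemma component_edge:
  assumes "e \<in> E" "v \<in> e" "v \<in> component E W x" "x \<in> W" "w \<in> e" "w \<in> W"
  shows "w \<in> component E W x"
proof -
  have "v \<in> W" using component_subset[OF assms(4)] assms(3) by auto
  then have "(v, w) \<in> adjacency E W" using assms by (auto simp: adjacency_def)
  then show ?thesis using assms(3) by (auto simp: component_def)
qed

lemma tree_decomposition_connected_bags:
  assumes T: "tree_decomposition H T B" and v: "v \<in> hverts H"
  shows "{u \<in> pverts T. v \<in> B u} \<noteq> {}" "connected_in (parcs T) {u \<in> pverts T. v \<in> B u}"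
proof -
  have "sym (parcs T)"
    using T pair_graph_sym unfolding tree_decomposition_def undirected_tree_def by blast
  from connected_induce_iff[OF this] show "{u \<in> pverts T. v \<in> B u} \<noteq> {}"
    "connected_in (parcs T) {u \<in> pverts T. v \<in> B u}"
    using T v unfolding tree_decomposition_def by blast+
qed

lemma connected_in_mono_pairs:
  "connected_in E K \<Longrightarrow> K \<subseteq> L \<Longrightarrow> x \<in> K \<Longrightarrow> y \<in> K \<Longrightarrow> (x, y) \<in> (E \<inter> L \<times> L)\<^sup>*"
  unfolding connected_in_def by (meson Int_mono Sigma_mono order_refl rtrancl_mono subsetD)

text \<open>Consecutive vertices of a walk in the component share a hyperedge, and a node whose bag
  contains it belongs to the subtrees of both; so the subtrees along the walk chain
  together.\<close>

lemma component_bags_connected: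
  assumes T: "tree_decomposition H T B" and W: "W \<subseteq> hverts H" "x \<in> W"
  defines "K \<equiv> {t \<in> pverts T. B t \<inter> component (hedges H) W x \<noteq> {}}"
  shows "K \<noteq> {}" "connected_in (parcs T) K"
proof -
  let ?D = "component (hedges H) W x"
  have DW: "?D \<subseteq> W" using component_subset[OF W(2)] .
  have bags: "{u \<in> pverts T. v \<in> B u} \<subseteq> K" if "v \<in> ?D" for v
    using that by (auto simp: K_def)
  have "x \<in> hverts H" using W by auto
  from tree_decomposition_connected_bags(1)[OF T this] show "K \<noteq> {}"
    using bags[OF component_self] by blast
  show "connected_in (parcs T) K"
    unfolding connected_in_def
  proof (intro ballI)
    fix a b assume ab: "a \<in> K" "b \<in> K"
    then obtain v w where v: "v \<in> B a" "v \<in> ?D" and w: "w \<in> B b" "w \<in> ?D" by (auto simp: K_def)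
    have aT: "a \<in> pverts T" "b \<in> pverts T" using ab by (auto simp: K_def)
    have "(v, w) \<in> (adjacency (hedges H) W)\<^sup>*" using component_reach[OF v(2) w(2)] .
    then show "(a, b) \<in> (parcs T \<inter> K \<times> K)\<^sup>*"
      using w aT(2)
    proof (induction arbitrary: b rule: rtrancl_induct)
      case base
      have "v \<in> hverts H" using v(2) DW W(1) by auto
      from tree_decomposition_connected_bags(2)[OF T this] show ?case
        by (rule connected_in_mono_pairs[OF _ bags[OF v(2)]]) (use v aT base in auto)
    next
      case (step w w')
      obtain e where e: "e \<in> hedges H" "w \<in> e" "w' \<in> e" using step(2) by (auto simp: adjacency_def)
      obtain c where c: "c \<in> pverts T" "e \<subseteq> B c" using T e(1) unfolding tree_decomposition_def by blast
      have wD: "w \<in> ?D"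
        using component_edge[of e "hedges H" w' W x w] e step.prems(2) W(2) step(2)
        by (auto simp: adjacency_def)
      have "(a, c) \<in> (parcs T \<inter> K \<times> K)\<^sup>*" using step.IH[of c] c e wD by auto
      moreover have "w' \<in> hverts H" using step.prems(2) DW W(1) by auto
      from tree_decomposition_connected_bags(2)[OF T this] have "(c, b) \<in> (parcs T \<inter> K \<times> K)\<^sup>*"
        by (rule connected_in_mono_pairs[OF _ bags[OF step.prems(2)]]) (use c e step.prems in auto)
      ultimately show ?case by (rule rtrancl_trans)
    qed
  qed
qed

text \<open>
  If every \<open>S\<close> failed, the components meeting more than half of \<open>M\<close> would pairwise share an
  edge of \<open>M\<close>. By Helly some bag would meet all of them, including the one that avoids a cover
  of that very bag.
\<close>

theorem balanced_separator:
  assumes H: "hypergraph H" and T: "tree_decomposition H T B"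
    and cover: "\<And>u. u \<in> pverts T \<Longrightarrow> \<exists>S\<subseteq>hedges H. card S \<le> k \<and> B u \<subseteq> \<Union>S"
    and M: "M \<subseteq> hedges H" "card M \<le> 2 * k + 1"
  shows "\<exists>S P. balanced_separation (hverts H) (hedges H) k M S P"
proof (rule ccontr)
  assume none: "\<not> ?thesis"
  let ?V = "hverts H" and ?E = "hedges H"
  have finM: "finite M" using M hypergraph_finite_edges[OF H] finite_subset by blast
  have big: "\<exists>x\<in>?V - \<Union>S. k < card {m \<in> M. m \<inter> component ?E (?V - \<Union>S) x \<noteq> {}}"
    if S: "S \<subseteq> ?E" "card S \<le> k" for S
  proof (rule ccontr)
    let ?W = "?V - \<Union>S"
    assume "\<not> ?thesis"
    then have small: "card {m \<in> M. m \<inter> component ?E ?W x \<noteq> {}} \<le> k" if "x \<in> ?W" for x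
      using that by (meson not_le)
    have "balanced_separation ?V ?E k M S (component ?E ?W ` ?W)"
      unfolding balanced_separation_def
    proof (intro conjI S ballI impI)
      show "\<Union>(component ?E ?W ` ?W) = ?W"
        using component_subset[of _ ?W ?E] component_self[of _ ?E ?W] by blast
      show "disjoint (component ?E ?W ` ?W)"
        unfolding disjoint_def using component_eq[of _ ?E ?W] by blast
    next
      fix D e assume D: "D \<in> component ?E ?W ` ?W" and e: "e \<in> ?E" "e \<inter> D \<noteq> {}"
      then obtain x v where xv: "x \<in> ?W" "D = component ?E ?W x" "v \<in> e" "v \<in> D" by auto
      show "e \<subseteq> D \<union> \<Union>S"
      proof
        fix w assume "w \<in> e"
        then have "w \<in> ?V" using H e(1) by (auto simp: hypergraph_def)
        then show "w \<in> D \<union> \<Union>S"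
          using component_edge[of e ?E v ?W x w] e(1) xv \<open>w \<in> e\<close> by auto
      qed
    next
      fix D assume "D \<in> component ?E ?W ` ?W"
      then show "card {m \<in> M. m \<inter> D \<noteq> {}} \<le> k" using small by auto
    qed
    then show False using none by blast
  qed
  define \<S> where "\<S> = {S. S \<subseteq> ?E \<and> card S \<le> k}"
  have "\<forall>S\<in>\<S>. \<exists>x. x \<in> ?V - \<Union>S \<and> k < card {m \<in> M. m \<inter> component ?E (?V - \<Union>S) x \<noteq> {}}"
    using big unfolding \<S>_def by blast
  from bchoice[OF this] obtain c where c: "\<And>S. S \<in> \<S> \<Longrightarrow> c S \<in> ?V - \<Union>S"
    "\<And>S. S \<in> \<S> \<Longrightarrow> k < card {m \<in> M. m \<inter> component ?E (?V - \<Union>S) (c S) \<noteq> {}}"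
    by blast
  define Q where "Q S = component ?E (?V - \<Union>S) (c S)" for S
  define K where "K S = {t \<in> pverts T. B t \<inter> Q S \<noteq> {}}" for S
  have tree: "undirected_tree T" using T by (simp add: tree_decomposition_def)
  have "finite (pverts T)" "sym (parcs T)"
    using tree pair_graph_sym pair_graph_finite by (auto simp: undirected_tree_def)
  moreover have "\<Inter>(K ` \<S>) \<noteq> {}" if "finite (pverts T)" "sym (parcs T)"
  proof (rule helly_acyclic[OF that undirected_tree_no_cycle[OF tree]])
    have "{} \<in> \<S>" by (simp add: \<S>_def)
    then show "K ` \<S> \<noteq> {}" by blast
    show "L \<noteq> {} \<and> L \<subseteq> pverts T \<and> connected_in (parcs T) L" if L: "L \<in> K ` \<S>" for L
    proof -
      obtain S where S: "S \<in> \<S>" "L = K S" using L by blast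
      have "K S \<noteq> {}" "connected_in (parcs T) (K S)"
        using component_bags_connected[OF T _ c(1)[OF S(1)]] unfolding K_def Q_def by blast+
      then show ?thesis using S(2) by (auto simp: K_def)
    qed
    show "L \<inter> L' \<noteq> {}" if L: "L \<in> K ` \<S>" "L' \<in> K ` \<S>" for L L'
    proof -
      obtain S S' where S: "S \<in> \<S>" "L = K S" "S' \<in> \<S>" "L' = K S'" using L by auto
      let ?A = "\<lambda>S. {m \<in> M. m \<inter> Q S \<noteq> {}}"
      \<comment> \<open>Two subfamilies of \<open>M\<close> with more than \<open>k\<close> members
        each cannot be disjoint, since \<open>2 * (k + 1) > 2 * k + 1\<close>.\<close>
      have "?A S \<inter> ?A S' \<noteq> {}"
      proof
        assume "?A S \<inter> ?A S' = {}"
        then have "card (?A S) + card (?A S') = card (?A S \<union> ?A S')"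
          using finM by (intro card_Un_disjoint[symmetric]) auto
        also have "\<dots> \<le> card M" by (rule card_mono[OF finM]) auto
        finally show False using c(2)[OF S(1)] c(2)[OF S(3)] M(2) by (simp add: Q_def)
      qed
      then obtain m where m: "m \<in> M" "m \<inter> Q S \<noteq> {}" "m \<inter> Q S' \<noteq> {}" by auto
      then obtain t where "t \<in> pverts T" "m \<subseteq> B t"
        using T M(1) unfolding tree_decomposition_def by blast
      then have "t \<in> K S \<inter> K S'" using m by (auto simp: K_def)
      then show ?thesis using S by auto
    qed
  qed
  ultimately obtain t where t: "\<And>S. S \<in> \<S> \<Longrightarrow> t \<in> K S" by blast
  have "t \<in> pverts T" using t[of "{}"] by (simp add: \<S>_def K_def)
  from cover[OF this] obtain S where S: "S \<in> \<S>" "B t \<subseteq> \<Union>S" by (auto simp: \<S>_def)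
  have "Q S \<inter> \<Union>S = {}" using component_subset[OF c(1)[OF S(1)], of ?E] by (auto simp: Q_def)
  then show False using t[OF S(1)] S(2) by (auto simp: K_def)
qed

section \<open>Laminar families and hypertree decompositions\<close>

text \<open>
  A node \<open>(K, \<Lambda>)\<close> stands for the bag \<open>\<Union>\<Lambda> \<inter> closed_nbhd E K\<close> with cover \<open>\<Lambda>\<close>, and \<open>K\<close> holds the
  vertices whose topmost bag lies in the subtree of that node. The tree order is inclusion of
  the sets \<open>K\<close>, so subtrees are glued together by taking unions.
\<close>

locale laminar_decomposition =
  fixes E :: "'a set set" and w :: nat and C :: "'a set" and \<Lambda>0 :: "'a set set"
    and F :: "('a set \<times> 'a set set) set"
  assumes finite_nodes: "finite F"
    and root_node: "(C, \<Lambda>0) \<in> F"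
    and node: "(K, \<Lambda>) \<in> F \<Longrightarrow> K \<subseteq> C \<and> \<Lambda> \<subseteq> E \<and> card \<Lambda> \<le> w \<and>
        closed_nbhd E K \<subseteq> K \<union> \<Union>\<Lambda> \<and> (K = {} \<or> K \<inter> \<Union>\<Lambda> \<noteq> {})"
    and parent_node: "(K, \<Lambda>) \<in> F \<Longrightarrow> (K, \<Lambda>) \<noteq> (C, \<Lambda>0) \<Longrightarrow>
        \<exists>K' \<Lambda>'. (K', \<Lambda>') \<in> F \<and> K \<subset> K' \<and> closed_nbhd E K \<subseteq> K \<union> \<Union>\<Lambda>'"
    and laminar: "(K, \<Lambda>) \<in> F \<Longrightarrow> (K', \<Lambda>') \<in> F \<Longrightarrow> (K, \<Lambda>) \<noteq> (K', \<Lambda>') \<Longrightarrow> K \<inter> K' \<noteq> {} \<Longrightarrow>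
        K \<subseteq> K' - \<Union>\<Lambda>' \<or> K' \<subseteq> K - \<Union>\<Lambda>"
    and top_node: "v \<in> C \<Longrightarrow> \<exists>K \<Lambda>. (K, \<Lambda>) \<in> F \<and> v \<in> K \<inter> \<Union>\<Lambda>"

lemmas laminar_decompositionD =
  laminar_decomposition.finite_nodes laminar_decomposition.root_node
  laminar_decomposition.node laminar_decomposition.parent_node
  laminar_decomposition.laminar laminar_decomposition.top_node

text \<open>
  The set \<open>M\<close> covers the boundary of \<open>C\<close>. The extra edge \<open>e0\<close> makes every child strictly smaller
  than \<open>C\<close>, and a child behind the separator \<open>S\<close> inherits only \<open>S\<close> and the at most \<open>k\<close> edges of
  \<open>insert e0 M\<close> that reach it, so its boundary cover again has at most \<open>2k\<close> edges.
\<close>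

theorem laminar_decomposition_exists:
  assumes E: "finite V" "E \<subseteq> Pow V" "V \<subseteq> \<Union>E"
    and sep: "\<And>M. M \<subseteq> E \<Longrightarrow> card M \<le> 2 * k + 1 \<Longrightarrow> \<exists>S P. balanced_separation V E k M S P"
    and "C \<subseteq> V" "C \<noteq> {}" "M \<subseteq> E" "card M \<le> 2 * k" "closed_nbhd E C \<subseteq> C \<union> \<Union>M"
  shows "\<exists>\<Lambda> F. laminar_decomposition E (3 * k + 1) C \<Lambda> F"
  using assms(5-)
proof (induction "card C" arbitrary: C M rule: less_induct)
  case less
  have finE: "finite E" using E(1,2) by (meson finite_Pow_iff finite_subset)
  have finC: "finite C" using less.prems(1) E(1) finite_subset by blast
  obtain e0 where e0: "e0 \<in> E" "e0 \<inter> C \<noteq> {}" using less.prems(1,2) E(3) by blast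
  define M' where "M' = insert e0 M"
  have M': "M' \<subseteq> E" "card M' \<le> 2 * k + 1"
    using less.prems(3,4) e0 finite_subset[OF less.prems(3) finE] by (auto simp: M'_def card_insert_if)
  from sep[OF this] obtain S P where "balanced_separation V E k M' S P" by blast
  then have S: "S \<subseteq> E" "card S \<le> k" and P: "\<Union>P = V - \<Union>S" "disjoint P"
    and Pe: "\<And>D e. D \<in> P \<Longrightarrow> e \<in> E \<Longrightarrow> e \<inter> D \<noteq> {} \<Longrightarrow> e \<subseteq> D \<union> \<Union>S"
    and Pbal: "\<And>D. D \<in> P \<Longrightarrow> card {m \<in> M'. m \<inter> D \<noteq> {}} \<le> k"
    unfolding balanced_separation_def by auto
  define \<Lambda>0 where "\<Lambda>0 = M' \<union> S"
  \<comment> \<open>Vertices of \<open>C\<close> in \<open>\<Union>\<Lambda>0\<close> have their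
    topmost bag at the new node; only the others are passed on to the children.\<close>
  define part where "part D = C \<inter> D - \<Union>\<Lambda>0" for D
  define N where "N D = {m \<in> M'. m \<inter> D \<noteq> {}} \<union> S" for D
  define \<D> where "\<D> = {D \<in> P. part D \<noteq> {}}"
  have "P \<subseteq> Pow V" using P(1) by blast
  then have fin\<D>: "finite \<D>" unfolding \<D>_def using E(1) by (auto intro: finite_subset[of _ "Pow V"])
  have root: "\<Lambda>0 \<subseteq> E" "card \<Lambda>0 \<le> 3 * k + 1" "closed_nbhd E C \<subseteq> C \<union> \<Union>\<Lambda>0" "C \<inter> \<Union>\<Lambda>0 \<noteq> {}"
    using M' S less.prems(5) e0 card_Un_le[of M' S] by (auto simp: \<Lambda>0_def M'_def)
  have N\<Lambda>: "N D \<subseteq> \<Lambda>0" for D by (auto simp: N_def \<Lambda>0_def)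
  \<comment> \<open>A hyperedge touching \<open>part D\<close> stays within
    \<open>D \<union> \<Union>S\<close> by separation and within \<open>C \<union> \<Union>M\<close>
    by the boundary condition. A vertex of it outside \<open>part D\<close> and
    \<open>\<Union>S\<close> thus lies in \<open>D\<close> and in a hyperedge of \<open>M'\<close>,
    which then meets \<open>D\<close>.\<close>
  have nbhd: "closed_nbhd E (part D) \<subseteq> part D \<union> \<Union>(N D)" if D: "D \<in> P" for D
  proof
    fix v assume "v \<in> closed_nbhd E (part D)"
    then consider "v \<in> part D" | e where "e \<in> E" "e \<inter> part D \<noteq> {}" "v \<in> e"
      by (auto simp: closed_nbhd_def)
    then show "v \<in> part D \<union> \<Union>(N D)"
    proof cases
      case 2
      then have "v \<in> D \<union> \<Union>S" using Pe[OF D, of e] by (auto simp: part_def)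
      moreover have "e \<inter> C \<noteq> {}" using 2(2) by (auto simp: part_def)
      then have "v \<in> C \<union> \<Union>M" using less.prems(5) edge_subset_closed_nbhd[of e E C] 2 by blast
      ultimately show ?thesis by (auto simp: part_def N_def \<Lambda>0_def M'_def)
    qed simp
  qed
  have "\<exists>\<Lambda> F. laminar_decomposition E (3 * k + 1) (part D) \<Lambda> F" if D: "D \<in> \<D>" for D
  proof (rule less.hyps)
    have DP: "D \<in> P" using D by (simp add: \<D>_def)
    have "part D \<subset> C" using e0 by (auto simp: part_def \<Lambda>0_def M'_def)
    then show "card (part D) < card C" using finC by (simp add: psubset_card_mono)
    show "part D \<subseteq> V" using less.prems(1) by (auto simp: part_def)
    show "part D \<noteq> {}" using D by (simp add: \<D>_def)
    show "N D \<subseteq> E" using M' S by (auto simp: N_def)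
    show "card (N D) \<le> 2 * k"
      using card_Un_le[of "{m \<in> M'. m \<inter> D \<noteq> {}}" S] Pbal[OF DP] S(2) by (simp add: N_def)
    show "closed_nbhd E (part D) \<subseteq> part D \<union> \<Union>(N D)" using nbhd[OF DP] .
  qed
  then obtain \<Lambda> F where IH: "\<And>D. D \<in> \<D> \<Longrightarrow> laminar_decomposition E (3 * k + 1) (part D) (\<Lambda> D) (F D)"
    by metis
  note IHD = laminar_decompositionD[OF IH]
  let ?F = "insert (C, \<Lambda>0) (\<Union>D\<in>\<D>. F D)"
  have part: "part D \<subset> C" "part D \<subseteq> C - \<Union>\<Lambda>0" for D
    using root(4) by (auto simp: part_def)
  have "laminar_decomposition E (3 * k + 1) C \<Lambda>0 ?F"
  proof (rule laminar_decomposition.intro)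
    show "finite ?F" using fin\<D> IHD(1) by auto
    show "(C, \<Lambda>0) \<in> ?F" by simp
  next
    fix K L assume "(K, L) \<in> ?F"
    then consider "K = C" "L = \<Lambda>0" | D where "D \<in> \<D>" "(K, L) \<in> F D" by auto
    then show "K \<subseteq> C \<and> L \<subseteq> E \<and> card L \<le> 3 * k + 1 \<and> closed_nbhd E K \<subseteq> K \<union> \<Union>L \<and>
        (K = {} \<or> K \<inter> \<Union>L \<noteq> {})"
    proof cases
      case 2
      then show ?thesis using IHD(3)[OF 2] part(1)[of D] by auto
    qed (use root in auto)
  next
    fix K L assume KL: "(K, L) \<in> ?F" "(K, L) \<noteq> (C, \<Lambda>0)"
    then obtain D where D: "D \<in> \<D>" "(K, L) \<in> F D" by auto
    show "\<exists>K' \<Lambda>'. (K', \<Lambda>') \<in> ?F \<and> K \<subset> K' \<and> closed_nbhd E K \<subseteq> K \<union> \<Union>\<Lambda>'"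
    proof (cases "(K, L) = (part D, \<Lambda> D)")
      case True
      then have "closed_nbhd E K \<subseteq> K \<union> \<Union>\<Lambda>0"
        using nbhd[of D] N\<Lambda>[of D] D(1) by (auto simp: \<D>_def)
      then show ?thesis using part(1)[of D] True by blast
    next
      case False
      from IHD(4)[OF D(1,2) False] D(1) show ?thesis by blast
    qed
  next
    fix K L K' L'
    assume KL: "(K, L) \<in> ?F" "(K', L') \<in> ?F" "(K, L) \<noteq> (K', L')" "K \<inter> K' \<noteq> {}"
    have sub: "K \<subseteq> C - \<Union>\<Lambda>0" if "D \<in> \<D>" "(K, L) \<in> F D" for D K L
      using IHD(3)[OF that] part(2)[of D] by blast
    consider "(K, L) = (C, \<Lambda>0)" | "(K', L') = (C, \<Lambda>0)"
      | D D' where "D \<in> \<D>" "(K, L) \<in> F D" "D' \<in> \<D>" "(K', L') \<in> F D'"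
      using KL(1,2) by auto
    then show "K \<subseteq> K' - \<Union>L' \<or> K' \<subseteq> K - \<Union>L"
    proof cases
      case 1
      then show ?thesis using KL sub[of _ K' L'] by auto
    next
      case 2
      then show ?thesis using KL sub[of _ K L] by auto
    next
      case 3
      have "K \<subseteq> D" "K' \<subseteq> D'" using IHD(3)[OF 3(1,2)] IHD(3)[OF 3(3,4)] by (auto simp: part_def)
      then have "D = D'" using KL(4) P(2) 3(1,3) unfolding disjoint_def \<D>_def by blast
      then show ?thesis using IHD(5)[OF 3(1,2) _ KL(3,4)] 3(4) by blast
    qed
  next
    fix v assume v: "v \<in> C"
    show "\<exists>K \<Lambda>. (K, \<Lambda>) \<in> ?F \<and> v \<in> K \<inter> \<Union>\<Lambda>"
    proof (cases "v \<in> \<Union>\<Lambda>0")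
      case True
      then show ?thesis using v by blast
    next
      case False
      then have "v \<in> \<Union>P" using v less.prems(1) P(1) by (auto simp: \<Lambda>0_def)
      then obtain D where D: "D \<in> P" "v \<in> D" by blast
      then have "v \<in> part D" using v False by (auto simp: part_def)
      then have "D \<in> \<D>" using D by (auto simp: \<D>_def)
      from IHD(6)[OF this \<open>v \<in> part D\<close>] \<open>D \<in> \<D>\<close> show ?thesis by blast
    qed
  qed
  then show ?case by blast
qed

text \<open>The sets \<open>K\<close> shrink downwards, so all bags below \<open>u\<close> lie in
  \<open>closed_nbhd (hedges H) (K u)\<close>, whose intersection with \<open>\<Union>(L u)\<close>
  is the whole of \<open>B u\<close>. The condition on subtrees thus holds by the choice of
  bags.\<close>

theorem hw_le_of_laminar_decomposition:
  assumes H: "hypergraph H" and lam: "laminar_decomposition (hedges H) w (hverts H) \<Lambda>0 F"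
  shows "hw H \<le> enat w"
proof -
  let ?E = "hedges H" and ?V = "hverts H"
  note lamD = laminar_decompositionD[OF lam]
  obtain g where g: "bij_betw g {..<card F} F"
    using ex_bij_betw_nat_finite[OF lamD(1)] by (auto simp: lessThan_atLeast0)
  define N where "N = {..<card F}"
  define K where "K u = fst (g u)" for u
  define L where "L u = snd (g u)" for u
  define B where "B u = \<Union>(L u) \<inter> closed_nbhd ?E (K u)" for u
  have gF: "(K u, L u) \<in> F" if "u \<in> N" for u
    using that g by (auto simp: K_def L_def N_def bij_betw_def)
  have g_inj: "(K u, L u) \<noteq> (K u', L u')" if "u \<in> N" "u' \<in> N" "u \<noteq> u'" for u u'
    using that g by (auto simp: K_def L_def N_def bij_betw_def inj_on_def prod_eq_iff)
  have g_surj: "\<exists>u\<in>N. K u = Q \<and> L u = R" if "(Q, R) \<in> F" for Q R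
  proof -
    have "(Q, R) \<in> g ` {..<card F}" using that g by (simp add: bij_betw_def)
    then show ?thesis by (auto simp: K_def L_def N_def) (metis fst_conv snd_conv lessThan_iff)
  qed
  obtain r where r: "r \<in> N" "K r = ?V" "L r = \<Lambda>0" using g_surj[OF lamD(2)] by blast
  have node: "K u \<subseteq> ?V \<and> L u \<subseteq> ?E \<and> card (L u) \<le> w \<and> closed_nbhd ?E (K u) \<subseteq> K u \<union> \<Union>(L u) \<and>
      (K u = {} \<or> K u \<inter> \<Union>(L u) \<noteq> {})" if "u \<in> N" for u
    using lamD(3)[OF gF[OF that]] .
  have finK: "finite (K u)" if "u \<in> N" for u
    using node[OF that] H finite_subset by (auto simp: hypergraph_def)
  have "\<exists>p. p \<in> N \<and> K u \<subset> K p \<and> closed_nbhd ?E (K u) \<subseteq> K u \<union> \<Union>(L p)" if "u \<in> N" "u \<noteq> r" for u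
  proof -
    have "(K u, L u) \<noteq> (?V, \<Lambda>0)" using g_inj[OF that(1) r(1) that(2)] r by simp
    from lamD(4)[OF gF[OF that(1)] this] show ?thesis using g_surj by metis
  qed
  then obtain \<pi> where \<pi>: "\<And>u. u \<in> N \<Longrightarrow> u \<noteq> r \<Longrightarrow>
      \<pi> u \<in> N \<and> K u \<subset> K (\<pi> u) \<and> closed_nbhd ?E (K u) \<subseteq> K u \<union> \<Union>(L (\<pi> u))"
    by metis
  interpret rooted_parent N r \<pi> "\<lambda>u. card (K u)"
  proof
    show "\<pi> u \<in> N \<and> card (K u) < card (K (\<pi> u))" if "u \<in> N" "u \<noteq> r" for u
      using \<pi>[OF that] finK by (simp add: psubset_card_mono)
  qed (use r in \<open>auto simp: N_def\<close>)
  have top: "\<exists>t\<in>N. v \<in> K t \<inter> \<Union>(L t)" if "v \<in> ?V" for v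
    using lamD(6)[OF that] g_surj by metis
  have lamN: "K u \<subseteq> K u' - \<Union>(L u') \<or> K u' \<subseteq> K u - \<Union>(L u)"
    if "u \<in> N" "u' \<in> N" "u \<noteq> u'" "v \<in> K u" "v \<in> K u'" for u u' v
    using lamD(5)[OF gF[OF that(1)] gF[OF that(2)] g_inj[OF that(1-3)]] that(4,5) by blast
  have top_unique: "u = u'" if "u \<in> N" "u' \<in> N" "v \<in> K u \<inter> \<Union>(L u)" "v \<in> K u' \<inter> \<Union>(L u')" for u u' v
    using lamN[OF that(1,2), of v] that(3,4) by blast
  have BV: "B u \<subseteq> ?V" if "u \<in> N" for u
    using node[OF that] H unfolding B_def hypergraph_def by blast
  have edge: "\<exists>u\<in>N. e \<subseteq> B u" if e: "e \<in> ?E" for e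
  proof (cases "e = {}")
    case True
    then show ?thesis using r by auto
  next
    case False
    have "e \<inter> K r \<noteq> {}" using e False H r by (auto simp: hypergraph_def)
    \<comment> \<open>The smallest \<open>K u\<close> meeting \<open>e\<close> works: a vertex of
      \<open>e\<close> outside \<open>\<Union>(L u)\<close> would lie in \<open>K u\<close>, and its
      topmost node would have a strictly smaller set that still meets \<open>e\<close>.\<close>
    then obtain u where u: "u \<in> N" "e \<inter> K u \<noteq> {}"
      and min: "\<And>u'. u' \<in> N \<Longrightarrow> e \<inter> K u' \<noteq> {} \<Longrightarrow> card (K u) \<le> card (K u')"
      using ex_has_least_nat[of "\<lambda>u. u \<in> N \<and> e \<inter> K u \<noteq> {}" r "\<lambda>u. card (K u)"] r(1) by blast
    have cl: "e \<subseteq> closed_nbhd ?E (K u)" using edge_subset_closed_nbhd[OF e u(2)] .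
    have "v \<in> \<Union>(L u)" if v: "v \<in> e" for v
    proof (rule ccontr)
      assume nv: "v \<notin> \<Union>(L u)"
      then have vK: "v \<in> K u" using cl v node[OF u(1)] by blast
      have "v \<in> ?V" using e v H by (auto simp: hypergraph_def)
      then obtain t where t: "t \<in> N" "v \<in> K t \<inter> \<Union>(L t)" using top by blast
      then have "t \<noteq> u" using nv by auto
      then have "K t \<subseteq> K u - \<Union>(L u)" using lamN[of u t v] u(1) t vK by blast
      then have "K t \<subset> K u" using node[OF u(1)] vK by blast
      then have "card (K t) < card (K u)" using finK[OF u(1)] by (simp add: psubset_card_mono)
      moreover have "card (K u) \<le> card (K t)" using min[OF t(1)] t(2) v by blast
      ultimately show False by simp
    qed
    then show ?thesis using cl u(1) unfolding B_def by blast
  qed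
  have conn: "{u \<in> N. v \<in> B u} \<noteq> {} \<and> connected_in (parcs T) {u \<in> N. v \<in> B u}" if v: "v \<in> ?V" for v
  proof -
    obtain t where t: "t \<in> N" "v \<in> K t \<inter> \<Union>(L t)" using top[OF v] by blast
    then have tB: "t \<in> {u \<in> N. v \<in> B u}" using subset_closed_nbhd[of "K t" ?E] by (auto simp: B_def)
    \<comment> \<open>By laminarity \<open>t\<close> is the only node with
      \<open>v \<in> K t \<inter> \<Union>(L t)\<close>. At any other node whose bag holds
      \<open>v\<close>, the vertex lies on the boundary of \<open>K u\<close>, which the cover of
      the parent contains.\<close>
    have up: "u \<noteq> r \<and> \<pi> u \<in> {u \<in> N. v \<in> B u}" if u: "u \<in> {u \<in> N. v \<in> B u}" "u \<noteq> t" for u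
    proof -
      have uN: "u \<in> N" and vB: "v \<in> B u" using u(1) by auto
      have nK: "v \<notin> K u" using top_unique[OF uN t(1) _ t(2)] vB u(2) by (auto simp: B_def)
      then have ur: "u \<noteq> r" using v r by auto
      have "v \<in> \<Union>(L (\<pi> u))" using \<pi>[OF uN ur] vB nK by (auto simp: B_def)
      moreover have "v \<in> closed_nbhd ?E (K (\<pi> u))"
        using \<pi>[OF uN ur] closed_nbhd_mono[of "K u" "K (\<pi> u)" ?E] vB by (auto simp: B_def)
      ultimately show ?thesis using ur \<pi>[OF uN ur] by (auto simp: B_def)
    qed
    have "connected_in (parcs T) {u \<in> N. v \<in> B u}"
      by (rule connected_in_T[OF _ tB up]) auto
    then show ?thesis using tB by blast
  qed
  have "tree_decomposition H T B"
    unfolding tree_decomposition_def connected_induce_iff[OF sym_parcs_T] pverts_T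
    using undirected_tree_T BV edge conn by blast
  moreover have "\<Union>(L u) \<inter> (\<Union>w\<in>rooted_subtree T r u. B w) \<subseteq> B u" if "u \<in> N" for u
  proof -
    have "K w \<subseteq> K u" if w: "w \<in> rooted_subtree T r u" for w
      using rooted_subtree_T[OF w]
    proof (induction rule: converse_rtrancl_induct)
      case (step y z)
      then show ?case using \<pi> by blast
    qed simp
    then have "B w \<subseteq> closed_nbhd ?E (K u)" if "w \<in> rooted_subtree T r u" for w
      using closed_nbhd_mono[of "K w" "K u" ?E] that by (auto simp: B_def)
    then show ?thesis unfolding B_def by blast
  qed
  moreover have "L u \<subseteq> ?E \<and> B u \<subseteq> \<Union>(L u)" if "u \<in> N" for u
    using node[OF that] by (auto simp: B_def)
  ultimately have dec: "hypertree_decomposition H T r B L"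
    unfolding hypertree_decomposition_def using r(1) by simp
  have "(MAX u\<in>pverts T. card (L u)) \<le> w"
    using finite_V r(1) node by (intro Max.boundedI) auto
  then have "enat (MAX u\<in>pverts T. card (L u)) \<le> enat w" by simp
  then show ?thesis
    unfolding hw_def by (intro INF_lower2[of "(T, r, B, L)"]) (use dec in auto)
qed

theorem hw_le_of_covered_tree_decomposition:
  assumes H: "hypergraph H" and T: "tree_decomposition H T B"
    and cover: "\<And>u. u \<in> pverts T \<Longrightarrow> \<exists>S\<subseteq>hedges H. card S \<le> k \<and> B u \<subseteq> \<Union>S"
  shows "hw H \<le> enat (3 * k + 1)"
proof -
  have "\<exists>\<Lambda> F. laminar_decomposition (hedges H) (3 * k + 1) (hverts H) \<Lambda> F"
  proof (cases "hverts H = {}")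
    case True
    \<comment> \<open>Without vertices the recursion has no hyperedge meeting \<open>C\<close> to
      make progress with; a single empty node serves instead.\<close>
    have "laminar_decomposition (hedges H) (3 * k + 1) {} {} {({}, {})}"
      by (rule laminar_decomposition.intro) (auto simp: closed_nbhd_def)
    then show ?thesis using True by auto
  next
    case False
    show ?thesis
    proof (rule laminar_decomposition_exists)
      show V: "finite (hverts H)" "hedges H \<subseteq> Pow (hverts H)" using H by (auto simp: hypergraph_def)
      show "hverts H \<subseteq> \<Union>(hedges H)"
      proof
        fix v assume "v \<in> hverts H"
        from tree_decomposition_connected_bags(1)[OF T this]
        obtain u where "u \<in> pverts T" "v \<in> B u" by blast
        then show "v \<in> \<Union>(hedges H)" using cover[of u] by blast
      qed
      show "\<exists>S P. balanced_separation (hverts H) (hedges H) k M S P"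
        if "M \<subseteq> hedges H" "card M \<le> 2 * k + 1" for M
        using balanced_separator[OF H T cover that] .
      \<comment> \<open>The full vertex set has no boundary, so the recursion starts from
        \<open>M = {}\<close>.\<close>
      show "closed_nbhd (hedges H) (hverts H) \<subseteq> hverts H \<union> \<Union>{}"
        using V by (auto simp: closed_nbhd_def)
    qed (use False in auto)
  qed
  then show ?thesis using hw_le_of_laminar_decomposition[OF H] by blast
qed

section \<open>From bounded fractional width to bounded hypertree width\<close>

text \<open>Strictness replaces attainment of the infima: below \<open>c\<close> there is an actual
  decomposition with actual covers of its bags. A class with bound \<open>c\<close> is therefore
  treated with \<open>c + 1\<close>.\<close>

lemma fhw_less_imp_covers:
  assumes "fhw H < ereal c"
  obtains T :: "nat pair_pre_digraph" and B where "tree_decomposition H T B"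
    "\<And>u. u \<in> pverts T \<Longrightarrow> \<exists>\<gamma>. fractional_edge_cover H (B u) \<gamma> \<and> sum \<gamma> (hedges H) \<le> c"
proof -
  obtain T :: "nat pair_pre_digraph" and B where T: "tree_decomposition H T B"
    and less: "(MAX u\<in>pverts T. fractional_cover_number H (B u)) < ereal c"
    using assms unfolding fhw_def INF_less_iff by auto
  have "pair_graph T" using T by (simp add: tree_decomposition_def undirected_tree_def)
  then have fin: "finite (pverts T)" by (rule pair_graph_finite)
  have "\<exists>\<gamma>. fractional_edge_cover H (B u) \<gamma> \<and> sum \<gamma> (hedges H) \<le> c" if u: "u \<in> pverts T" for u
  proof -
    have "fractional_cover_number H (B u) \<le> (MAX u\<in>pverts T. fractional_cover_number H (B u))"
      using fin u by (intro Max_ge) auto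
    then have "fractional_cover_number H (B u) < ereal c" using less by (rule le_less_trans)
    then show ?thesis unfolding fractional_cover_number_def INF_less_iff by (auto intro: less_imp_le)
  qed
  then show thesis using that T by blast
qed

theorem theorem3:
  fixes C :: "'a hypergraph set"
  assumes "\<forall>H\<in>C. hypergraph H"
    and "\<not> bounded_hw C"
    and "bounded_fhw C"
  shows "exotic C"
proof (rule ccontr)
  assume "\<not> exotic C"
  then obtain n where n: "\<And>H U. H \<in> C \<Longrightarrow> U \<subseteq> hverts H \<Longrightarrow> card U = n \<Longrightarrow>
      \<not> 2 ^ n - 1 \<le> card (hedges (induced_subhypergraph H U))"
    unfolding exotic_def by blast
  obtain c where c: "\<And>H. H \<in> C \<Longrightarrow> fhw H \<le> ereal c"
    using assms(3) unfolding bounded_fhw_def by blast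
  obtain k where k: "\<forall>(H :: 'a hypergraph) X \<gamma>. hypergraph H \<longrightarrow>
      (\<forall>S\<subseteq>hedges H. shatters (edge_stars H) S \<longrightarrow> card S < 2 ^ n) \<longrightarrow>
      fractional_edge_cover H X \<gamma> \<longrightarrow> X \<subseteq> hverts H \<longrightarrow> sum \<gamma> (hedges H) \<le> c + 1 \<longrightarrow>
      (\<exists>S\<subseteq>hedges H. card S \<le> k \<and> X \<subseteq> \<Union>S)"
    using fractional_cover_imp_cover[of "2 ^ n" "c + 1"] by blast
  have "hw H \<le> enat (3 * k + 1)" if HC: "H \<in> C" for H
  proof -
    have H: "hypergraph H" using assms(1) HC by blast
    have "fhw H < ereal (c + 1)" using c[OF HC] by (rule le_less_trans) simp
    then obtain T :: "nat pair_pre_digraph" and B where T: "tree_decomposition H T B"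
      and frac: "\<And>u. u \<in> pverts T \<Longrightarrow>
        \<exists>\<gamma>. fractional_edge_cover H (B u) \<gamma> \<and> sum \<gamma> (hedges H) \<le> c + 1"
      using fhw_less_imp_covers by blast
    have vc: "card S < 2 ^ n" if "S \<subseteq> hedges H" "shatters (edge_stars H) S" for S
      using not_exotic_imp_bounded_dual_vc[OF n[OF HC] that(1) _ that(2)]
        finite_subset[OF that(1) hypergraph_finite_edges[OF H]] by blast
    note cover = k[rule_format, OF H vc]
    show ?thesis
    proof (rule hw_le_of_covered_tree_decomposition[OF H T])
      fix u assume u: "u \<in> pverts T"
      then have "B u \<subseteq> hverts H" using T by (simp add: tree_decomposition_def)
      then show "\<exists>S\<subseteq>hedges H. card S \<le> k \<and> B u \<subseteq> \<Union>S"
        using frac[OF u] cover by blast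
    qed
  qed
  then show False using assms(2) unfolding bounded_hw_def by blast
qed

end
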